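(* Let $M_n$ be the set (up to homeomorphism) of compact orientable $3$-manifolds with boundary admitting an ideal triangulation with $n$ ideal tetrahedra and exactly one edge, and let $A_n$ be the set of isomorphism classes of connected simple $4$-regular graphs with $n$ vertices. Then $\ln|M_n| \leq \ln(|A_n|)+n (1+\ln(270))$.
   Context: A simple graph means a connected graph without loops and multiple edges; a $4$-regular graph is one in which every vertex has degree $4$. *)

theory Defs
  imports "HOL-Analysis.Analysis" "HOL-Homology.Homology" "Graph_Theory.Digraph_Isomorphism"
begin

section \<open>Orientable 3-manifolds with boundary\<close>

definition half_space3 :: "(nat \<Rightarrow> real) topology" where
  "half_space3 = subtopology (Euclidean_space 3) {y. 0 \<le> y 0}"

definition chart_at :: "'a topology \<Rightarrow> 'b topology \<Rightarrow> 'a \<Rightarrow> bool" where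
  "chart_at X Y x \<longleftrightarrow> (\<exists>U V. openin X U \<and> x \<in> U \<and> openin Y V \<and>
     subtopology X U homeomorphic_space subtopology Y V)"

definition manifold3_with_boundary :: "'a topology \<Rightarrow> bool" where
  "manifold3_with_boundary X \<longleftrightarrow> Hausdorff_space X \<and> second_countable X \<and>
     (\<forall>x \<in> topspace X. chart_at X half_space3 x)"

definition manifold3_interior :: "'a topology \<Rightarrow> 'a set" where
  "manifold3_interior X = {x \<in> topspace X. chart_at X (Euclidean_space 3) x}"

text \<open>An orientation of a 3-manifold without boundary is a choice of generators of the local
  homology groups \<open>H\<^sub>3(X, X - {x})\<close> that is locally consistent, i.e. near every point it is induced
  by a single class of \<open>H\<^sub>3(X, X - U)\<close> with \<open>U\<close> an open neighbourhood of that point.\<close>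

definition is_orientation3 :: "'a topology \<Rightarrow> ('a \<Rightarrow> 'a chain set) \<Rightarrow> bool" where
  "is_orientation3 X \<mu> \<longleftrightarrow>
     (\<forall>x \<in> topspace X.
        \<mu> x \<in> carrier (relative_homology_group 3 X (topspace X - {x})) \<and>
        generate (relative_homology_group 3 X (topspace X - {x})) {\<mu> x} =
          carrier (relative_homology_group 3 X (topspace X - {x}))) \<and>
     (\<forall>x \<in> topspace X. \<exists>U \<alpha>. openin X U \<and> x \<in> U \<and>
        \<alpha> \<in> carrier (relative_homology_group 3 X (topspace X - U)) \<and>
        (\<forall>y \<in> U. hom_induced 3 X (topspace X - U) X (topspace X - {y}) id \<alpha> = \<mu> y))"

text \<open>A manifold with boundary is orientable if its interior is.\<close>

definition orientable3 :: "'a topology \<Rightarrow> bool" where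
  "orientable3 X \<longleftrightarrow> (\<exists>\<mu>. is_orientation3 (subtopology X (manifold3_interior X)) \<mu>)"


section \<open>Ideal triangulations\<close>

text \<open>
  A gluing of \<open>n\<close> tetrahedra, numbered \<open>0, \<dots>, n - 1\<close> and each with vertices \<open>0, 1, 2, 3\<close>, is
  given by functions \<open>T\<close> and \<open>p\<close>. Face \<open>a\<close> of tetrahedron \<open>i\<close> (the one opposite to vertex \<open>a\<close>) is
  glued to face \<open>p i a a\<close> of tetrahedron \<open>T i a\<close>; the three vertices \<open>k \<noteq> a\<close> of the former go to
  the vertices \<open>p i a k\<close> of the latter. Sending \<open>a\<close> to \<open>p i a a\<close> merely completes this bijection
  to a permutation of \<open>{..3}\<close>. The faces are glued in pairs of distinct faces, with mutually
  inverse maps.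
\<close>

definition face_pairing ::
    "nat \<Rightarrow> (nat \<Rightarrow> nat \<Rightarrow> nat) \<Rightarrow> (nat \<Rightarrow> nat \<Rightarrow> nat \<Rightarrow> nat) \<Rightarrow> bool" where
  "face_pairing n T p \<longleftrightarrow> (\<forall>i<n. \<forall>a\<le>3.
     T i a < n \<and> p i a permutes {..3} \<and> (T i a, p i a a) \<noteq> (i, a) \<and>
     T (T i a) (p i a a) = i \<and> p (T i a) (p i a a) = inv_into UNIV (p i a))"

text \<open>
  An ideal triangulation of a compact manifold with boundary realizes it as a gluing of truncated
  tetrahedra along their lateral faces, so that its interior is the gluing of the tetrahedra with
  the vertices removed. In barycentric coordinates, the truncated tetrahedron is the standard
  simplex with open neighbourhoods of its ideal vertices cut off. Its lateral faces (hexagons) are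
  the sets \<open>x a = 0\<close>, and its truncation triangles \<open>x k = 2/3\<close> make up the boundary
  of the manifold.
\<close>

definition truncated_tetrahedron :: "(nat \<Rightarrow> real) set" where
  "truncated_tetrahedron = {x \<in> standard_simplex 3. \<forall>k. x k \<le> 2/3}"

definition tetrahedra_topology :: "nat \<Rightarrow> (nat \<times> (nat \<Rightarrow> real)) topology" where
  "tetrahedra_topology n =
     sum_topology (\<lambda>i. subtopology (powertop_real UNIV) truncated_tetrahedron) {..<n}"

text \<open>If \<open>p i a\<close> moves vertex \<open>k\<close> to vertex \<open>p i a k\<close>, then the point with barycentric coordinates
  \<open>x\<close> is moved by the affine extension to the one with coordinates \<open>x \<circ> inv_into UNIV (p i a)\<close>.\<close>

definition glue_points ::
    "nat \<Rightarrow> (nat \<Rightarrow> nat \<Rightarrow> nat) \<Rightarrow> (nat \<Rightarrow> nat \<Rightarrow> nat \<Rightarrow> nat) \<Rightarrow> (nat \<times> (nat \<Rightarrow> real)) rel" where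
  "glue_points n T p = {((i, x), (T i a, x \<circ> inv_into UNIV (p i a))) | i a x.
     i < n \<and> a \<le> 3 \<and> x \<in> truncated_tetrahedron \<and> x a = 0}"

text \<open>\<open>X\<close> is the quotient of the disjoint union of the tetrahedra by the equivalence relation
  generated by the gluings (\<open>glue_points\<close> is symmetric for a face pairing).\<close>

definition ideal_triangulation ::
    "nat \<Rightarrow> (nat \<Rightarrow> nat \<Rightarrow> nat) \<Rightarrow> (nat \<Rightarrow> nat \<Rightarrow> nat \<Rightarrow> nat) \<Rightarrow> 'a topology \<Rightarrow> bool" where
  "ideal_triangulation n T p X \<longleftrightarrow> face_pairing n T p \<and>
     (\<exists>q. quotient_map (tetrahedra_topology n) X q \<and>
        (\<forall>u \<in> topspace (tetrahedra_topology n). \<forall>v \<in> topspace (tetrahedra_topology n).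
           q u = q v \<longleftrightarrow> (u, v) \<in> (glue_points n T p)\<^sup>*))"

text \<open>An edge of a tetrahedron is a 2-element set of its vertices; the edges of the triangulation
  are the classes of the \<open>6 n\<close> edges of the tetrahedra under the gluings.\<close>

definition tetrahedra_edges :: "nat \<Rightarrow> (nat \<times> nat set) set" where
  "tetrahedra_edges n = {..<n} \<times> {e. e \<subseteq> {..3} \<and> card e = 2}"

definition glue_edges ::
    "nat \<Rightarrow> (nat \<Rightarrow> nat \<Rightarrow> nat) \<Rightarrow> (nat \<Rightarrow> nat \<Rightarrow> nat \<Rightarrow> nat) \<Rightarrow> (nat \<times> nat set) rel" where
  "glue_edges n T p = {((i, e), (T i a, p i a ` e)) | i a e.
     (i, e) \<in> tetrahedra_edges n \<and> a \<le> 3 \<and> a \<notin> e}"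

definition triangulation_edges ::
    "nat \<Rightarrow> (nat \<Rightarrow> nat \<Rightarrow> nat) \<Rightarrow> (nat \<Rightarrow> nat \<Rightarrow> nat \<Rightarrow> nat) \<Rightarrow> (nat \<times> nat set) set set" where
  "triangulation_edges n T p = tetrahedra_edges n // (glue_edges n T p)\<^sup>*"


section \<open>The sets of manifolds and graphs\<close>

definition one_edge_manifold :: "nat \<Rightarrow> 'a topology \<Rightarrow> bool" where
  "one_edge_manifold n X \<longleftrightarrow>
     manifold3_with_boundary X \<and> compact_space X \<and> orientable3 X \<and>
     (\<exists>T p. ideal_triangulation n T p X \<and> card (triangulation_edges n T p) = 1)"

text \<open>The set of homeomorphism classes is taken among spaces whose points lie in a type \<open>'a\<close>. Every
  such manifold has the cardinality of the continuum, so \<open>'a = real\<close> already represents all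
  homeomorphism classes; a statement polymorphic in \<open>'a\<close> covers this case.\<close>

definition manifold_classes :: "nat \<Rightarrow> 'a topology set set" where
  "manifold_classes n = {X. one_edge_manifold n X} // {(X, Y). X homeomorphic_space Y}"

text \<open>A \<open>pair_graph\<close> is a finite simple graph given by its symmetric, irreflexive set of arcs, so
  the degree of a vertex is its out-degree. Every graph with \<open>n\<close> vertices is isomorphic to one with
  vertex set \<open>{..<n}\<close>.\<close>

definition connected_simple_4_regular :: "nat pair_pre_digraph \<Rightarrow> bool" where
  "connected_simple_4_regular G \<longleftrightarrow>
     pair_graph G \<and> Digraph_Component.connected (with_proj G) \<and>
     (\<forall>v \<in> pverts G. out_degree (with_proj G) v = 4)"

definition graph_classes :: "nat \<Rightarrow> nat pair_pre_digraph set set" where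
  "graph_classes n = {G. connected_simple_4_regular G \<and> pverts G = {..<n}} //
     {(G, H). digraph_iso (with_proj G) (with_proj H)}"

end

theory Submission
  imports Defs
begin

text \<open>A one-edge triangulation is connected, so a relabelling of its tetrahedra and their vertices
  that fixes one labelled tetrahedron and preserves all gluings is trivial. Hence every manifold is
  realized by at least \<open>(n - 1)! 24\<^sup>n\<^sup>-\<^sup>1\<close> of the at most \<open>36\<^sup>n (4 n - 1)!!\<close> labelled face pairings,
  which leaves at most \<open>24 n 24\<^sup>n n!\<close> manifolds. On the other hand, adding to an \<open>n\<close>-cycle a
  permutation that moves three blocks of \<open>m \<approx> n / 3\<close> vertices cyclically gives \<open>(m - 1)!\<^sup>3\<close> labelled
  4-regular graphs, at most \<open>n 4\<^sup>n\<^sup>-\<^sup>1\<close> of them in one isomorphism class, because an isomorphism is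
  determined by the image of a Hamiltonian path. For \<open>n > 60\<close> the quotient of these numbers is
  below \<open>729\<^sup>n\<close>, where \<open>729 < 270 e\<close>; for \<open>n \<le> 60\<close> the bound on the manifolds already is.\<close>

section \<open>Relabelled gluings\<close>

text \<open>Each map is constant on the fibres of the other, so the universal property of quotients
  yields continuous maps in both directions, and these are mutually inverse.\<close>

lemma homeomorphic_space_of_quotient_maps:
  assumes f: "quotient_map Z X f" and g: "quotient_map Z Y g"
    and eq: "\<And>u v. u \<in> topspace Z \<Longrightarrow> v \<in> topspace Z \<Longrightarrow> f u = f v \<longleftrightarrow> g u = g v"
  shows "X homeomorphic_space Y"
proof -
  obtain h where h: "continuous_map X Y h" "\<And>z. z \<in> topspace Z \<Longrightarrow> h (f z) = g z"
    using quotient_map_lift_exists[OF f quotient_imp_continuous_map[OF g]] eq by metis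
  obtain k where k: "continuous_map Y X k" "\<And>z. z \<in> topspace Z \<Longrightarrow> k (g z) = f z"
    using quotient_map_lift_exists[OF g quotient_imp_continuous_map[OF f]] eq by metis
  have "f ` topspace Z = topspace X" "g ` topspace Z = topspace Y"
    using f g quotient_imp_surjective_map by blast+
  then have "homeomorphic_maps X Y h k"
    unfolding homeomorphic_maps_def using h k by auto (metis imageE)+
  then show ?thesis
    unfolding homeomorphic_space_def by blast
qed

lemma glue_points_cong:
  assumes "\<And>i a. i < n \<Longrightarrow> a \<le> 3 \<Longrightarrow> T i a = T' i a \<and> p i a = p' i a"
  shows "glue_points n T p = glue_points n T' p'"
  unfolding glue_points_def using assms by force

text \<open>\<open>T\<close> and \<open>p\<close> take arbitrary values outside the faces that
  exist, so agreement is asked only on those; this already makes the gluing relations equal.\<close>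

lemma ideal_triangulation_homeomorphic:
  assumes X: "ideal_triangulation n T p X" and Y: "ideal_triangulation n T' p' Y"
    and eq: "\<And>i a. i < n \<Longrightarrow> a \<le> 3 \<Longrightarrow> T i a = T' i a \<and> p i a = p' i a"
  shows "X homeomorphic_space Y"
proof -
  obtain f where f: "quotient_map (tetrahedra_topology n) X f"
      "\<forall>u \<in> topspace (tetrahedra_topology n). \<forall>v \<in> topspace (tetrahedra_topology n).
        f u = f v \<longleftrightarrow> (u, v) \<in> (glue_points n T p)\<^sup>*"
    using X unfolding ideal_triangulation_def by blast
  obtain g where g: "quotient_map (tetrahedra_topology n) Y g"
      "\<forall>u \<in> topspace (tetrahedra_topology n). \<forall>v \<in> topspace (tetrahedra_topology n).
        g u = g v \<longleftrightarrow> (u, v) \<in> (glue_points n T p)\<^sup>*"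
    using Y glue_points_cong[of n T T' p p', OF eq] unfolding ideal_triangulation_def by metis
  show ?thesis
    using homeomorphic_space_of_quotient_maps[OF f(1) g(1)] f(2) g(2) by blast
qed

lemma rtrancl_image:
  assumes "(u, v) \<in> R\<^sup>*" and "\<And>x y. (x, y) \<in> R \<Longrightarrow> (f x, f y) \<in> S"
  shows "(f u, f v) \<in> S\<^sup>*"
  using assms(1) by induction (auto intro: rtrancl_into_rtrancl assms(2))

lemma truncated_tetrahedron_permute:
  assumes s: "s permutes {..3}" and x: "x \<in> truncated_tetrahedron"
  shows "x \<circ> s \<in> truncated_tetrahedron"
proof -
  have "(\<Sum>i\<le>3. x (s i)) = (\<Sum>i\<le>3. x i)"
    using sum.permute[OF s, of x] by (simp add: o_def)
  moreover have "s i = i" if "i > 3" for i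
    using permutes_not_in[OF s] that by auto
  ultimately show ?thesis
    using x unfolding truncated_tetrahedron_def standard_simplex_def by auto
qed

lemma topspace_tetrahedra_topology:
  "topspace (tetrahedra_topology n) = {..<n} \<times> truncated_tetrahedron"
  unfolding tetrahedra_topology_def by auto

text \<open>The general form serves both \<open>relabel_points\<close> and its inverse
  \<open>unlabel_points\<close>. Openness in a sum topology is checked on one tetrahedron at a
  time.\<close>

lemma continuous_map_relabel_tetrahedra:
  assumes f: "\<And>i. i < n \<Longrightarrow> f i < n" and s: "\<And>i. i < n \<Longrightarrow> s i permutes {..3}"
  shows "continuous_map (tetrahedra_topology n) (tetrahedra_topology n) (\<lambda>(i, x). (f i, x \<circ> s i))"
proof -
  let ?D = "subtopology (powertop_real UNIV) truncated_tetrahedron"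
  have cont: "continuous_map ?D ?D (\<lambda>x. x \<circ> s i)" if "i < n" for i
  proof (rule continuous_map_into_subtopology)
    show "continuous_map ?D (powertop_real UNIV) (\<lambda>x. x \<circ> s i)"
      unfolding continuous_map_componentwise_UNIV o_def
      by (auto intro: continuous_map_from_subtopology continuous_map_product_projection)
    show "(\<lambda>x. x \<circ> s i) \<in> topspace ?D \<rightarrow> truncated_tetrahedron"
      using truncated_tetrahedron_permute[OF s[OF that]] by auto
  qed
  show ?thesis
    unfolding continuous_map_def
  proof (intro conjI allI impI)
    show "(\<lambda>(i, x). (f i, x \<circ> s i)) \<in> topspace (tetrahedra_topology n) \<rightarrow> topspace (tetrahedra_topology n)"
      using f truncated_tetrahedron_permute s by (auto simp: topspace_tetrahedra_topology)
    fix U assume "openin (tetrahedra_topology n) U"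
    then have U: "\<And>i. i < n \<Longrightarrow> openin ?D {x. (i, x) \<in> U}"
      unfolding tetrahedra_topology_def openin_sum_topology by auto
    have "openin ?D {x. (i, x) \<in> {u \<in> topspace (tetrahedra_topology n).
        (case u of (i, x) \<Rightarrow> (f i, x \<circ> s i)) \<in> U}}" if "i < n" for i
      using openin_continuous_map_preimage[OF cont[OF that] U[OF f[OF that]]] that
      by (simp add: topspace_tetrahedra_topology)
    then show "openin (tetrahedra_topology n)
        {u \<in> topspace (tetrahedra_topology n). (case u of (i, x) \<Rightarrow> (f i, x \<circ> s i)) \<in> U}"
      unfolding tetrahedra_topology_def openin_sum_topology by auto
  qed
qed

section \<open>Renaming tetrahedra and their vertices\<close>

text \<open>Tetrahedron \<open>i\<close> is renamed to \<open>\<pi> i\<close>, and its vertex \<open>a\<close> to \<open>s i a\<close>.\<close>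

definition relabel_tetrahedra ::
    "(nat \<Rightarrow> nat) \<Rightarrow> (nat \<Rightarrow> nat \<Rightarrow> nat) \<Rightarrow> (nat \<Rightarrow> nat \<Rightarrow> nat) \<Rightarrow> nat \<Rightarrow> nat \<Rightarrow> nat" where
  "relabel_tetrahedra \<pi> s T j b = (let i = inv_into UNIV \<pi> j in \<pi> (T i (inv_into UNIV (s i) b)))"

text \<open>A vertex is taken back to its old label, glued by \<open>p i a\<close>, and given its
  new label in the tetrahedron on the other side, hence \<open>s (T i a)\<close> on the left and
  \<open>s i\<close> on the right.\<close>

definition relabel_faces ::
    "(nat \<Rightarrow> nat) \<Rightarrow> (nat \<Rightarrow> nat \<Rightarrow> nat) \<Rightarrow> (nat \<Rightarrow> nat \<Rightarrow> nat) \<Rightarrow> (nat \<Rightarrow> nat \<Rightarrow> nat \<Rightarrow> nat) \<Rightarrow>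
      nat \<Rightarrow> nat \<Rightarrow> nat \<Rightarrow> nat" where
  "relabel_faces \<pi> s T p j b =
    (let i = inv_into UNIV \<pi> j; a = inv_into UNIV (s i) b in s (T i a) \<circ> p i a \<circ> inv_into UNIV (s i))"

locale relabelling =
  fixes n :: nat and \<pi> :: "nat \<Rightarrow> nat" and s :: "nat \<Rightarrow> nat \<Rightarrow> nat"
    and T :: "nat \<Rightarrow> nat \<Rightarrow> nat" and p :: "nat \<Rightarrow> nat \<Rightarrow> nat \<Rightarrow> nat"
  assumes \<pi>: "\<pi> permutes {..<n}" and s: "\<And>i. i < n \<Longrightarrow> s i permutes {..3}"
    and pairing: "face_pairing n T p"
begin

abbreviation "T' \<equiv> relabel_tetrahedra \<pi> s T"
abbreviation "p' \<equiv> relabel_faces \<pi> s T p"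

lemma T_less: "i < n \<Longrightarrow> a \<le> 3 \<Longrightarrow> T i a < n"
  and p_permutes: "i < n \<Longrightarrow> a \<le> 3 \<Longrightarrow> p i a permutes {..3}"
  using pairing unfolding face_pairing_def by blast+

lemma \<pi>_less: "\<pi> i < n \<longleftrightarrow> i < n"
  using permutes_in_image[OF \<pi>] by auto

lemma inv_\<pi>_less: "inv_into UNIV \<pi> i < n \<longleftrightarrow> i < n"
  using permutes_in_image[OF permutes_inv[OF \<pi>]] by auto

lemma \<pi>_inverses [simp]: "\<pi> (inv_into UNIV \<pi> i) = i" "inv_into UNIV \<pi> (\<pi> i) = i"
  using permutes_inverses[OF \<pi>] by auto

lemma s_inverses: "i < n \<Longrightarrow> s i (inv_into UNIV (s i) a) = a" "i < n \<Longrightarrow> inv_into UNIV (s i) (s i a) = a"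
  using permutes_inverses s by metis+

lemma s_le: "i < n \<Longrightarrow> s i a \<le> 3 \<longleftrightarrow> a \<le> 3"
  using permutes_in_image[OF s] by auto

lemma inv_s_le: "i < n \<Longrightarrow> inv_into UNIV (s i) a \<le> 3 \<longleftrightarrow> a \<le> 3"
  using permutes_in_image[OF permutes_inv[OF s]] by auto

lemma p_le: "i < n \<Longrightarrow> a \<le> 3 \<Longrightarrow> p i a k \<le> 3 \<longleftrightarrow> k \<le> 3"
  using permutes_in_image[OF p_permutes] by auto

lemma relabel_tetrahedra_image:
  "i < n \<Longrightarrow> T' (\<pi> i) (s i a) = \<pi> (T i a)"
  unfolding relabel_tetrahedra_def by (simp add: s_inverses)

lemma relabel_faces_image:
  "i < n \<Longrightarrow> p' (\<pi> i) (s i a) = s (T i a) \<circ> p i a \<circ> inv_into UNIV (s i)"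
  unfolding relabel_faces_def by (simp add: s_inverses)

lemma inv_relabel_faces_image:
  assumes "i < n" "a \<le> 3"
  shows "inv_into UNIV (p' (\<pi> i) (s i a)) = s i \<circ> inv_into UNIV (p i a) \<circ> inv_into UNIV (s (T i a))"
proof -
  have "bij (s (T i a))" "bij (p i a)" "bij (s i)"
    using assms s p_permutes T_less permutes_bij by metis+
  then show ?thesis
    using assms by (simp add: relabel_faces_image o_inv_distrib bij_comp bij_imp_bij_inv inv_inv_eq o_assoc)
qed

text \<open>Every face has the form \<open>(\<pi> i, s i a)\<close>, and there the new gluing has a
  simple formula.\<close>

lemma forall_relabelled:
  assumes "\<And>i a. i < n \<Longrightarrow> a \<le> 3 \<Longrightarrow> P (\<pi> i) (s i a)"
  shows "\<forall>i<n. \<forall>a\<le>3. P i a"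
  using assms inv_\<pi>_less inv_s_le \<pi>_inverses s_inverses by metis

lemma face_pairing_relabelled: "face_pairing n T' p'"
  unfolding face_pairing_def
proof (rule forall_relabelled)
  fix i a :: nat assume ia: "i < n" "a \<le> 3"
  let ?j = "T i a" and ?b = "p i a a"
  have j: "?j < n" "?b \<le> 3"
    using ia T_less p_le by auto
  have glued: "T ?j ?b = i" "p ?j ?b = inv_into UNIV (p i a)" "(?j, ?b) \<noteq> (i, a)"
    using pairing ia unfolding face_pairing_def by auto
  have T1: "T' (\<pi> i) (s i a) = \<pi> ?j"
    using ia by (simp add: relabel_tetrahedra_image)
  have p1: "p' (\<pi> i) (s i a) (s i a) = s ?j ?b"
    using ia by (simp add: relabel_faces_image s_inverses)
  have perm: "p' (\<pi> i) (s i a) permutes {..3}"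
    unfolding relabel_faces_image[OF ia(1)]
    using ia j s p_permutes by (intro permutes_compose permutes_inv) auto
  have ne: "(\<pi> ?j, s ?j ?b) \<noteq> (\<pi> i, s i a)"
    using glued(3) \<pi>_inverses(2) s_inverses(2) ia(1) by (metis Pair_inject)
  have "T' (\<pi> ?j) (s ?j ?b) = \<pi> i"
    using j glued by (simp add: relabel_tetrahedra_image)
  moreover have "p' (\<pi> ?j) (s ?j ?b) = inv_into UNIV (p' (\<pi> i) (s i a))"
    unfolding inv_relabel_faces_image[OF ia] using j glued by (simp add: relabel_faces_image)
  ultimately show "T' (\<pi> i) (s i a) < n \<and> p' (\<pi> i) (s i a) permutes {..3} \<and>
      (T' (\<pi> i) (s i a), p' (\<pi> i) (s i a) (s i a)) \<noteq> (\<pi> i, s i a) \<and>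
      T' (T' (\<pi> i) (s i a)) (p' (\<pi> i) (s i a) (s i a)) = \<pi> i \<and>
      p' (T' (\<pi> i) (s i a)) (p' (\<pi> i) (s i a) (s i a)) = inv_into UNIV (p' (\<pi> i) (s i a))"
    unfolding T1 p1 using perm ne j by (simp add: \<pi>_less)
qed

definition relabel_points :: "nat \<times> (nat \<Rightarrow> real) \<Rightarrow> nat \<times> (nat \<Rightarrow> real)" where
  "relabel_points = (\<lambda>(i, x). (\<pi> i, x \<circ> inv_into UNIV (s i)))"

definition unlabel_points :: "nat \<times> (nat \<Rightarrow> real) \<Rightarrow> nat \<times> (nat \<Rightarrow> real)" where
  "unlabel_points = (\<lambda>(j, x). (inv_into UNIV \<pi> j, x \<circ> s (inv_into UNIV \<pi> j)))"

lemma homeomorphic_maps_relabel_points: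
  "homeomorphic_maps (tetrahedra_topology n) (tetrahedra_topology n) unlabel_points relabel_points"
proof -
  have "continuous_map (tetrahedra_topology n) (tetrahedra_topology n) relabel_points"
    unfolding relabel_points_def
    by (rule continuous_map_relabel_tetrahedra) (use \<pi>_less s permutes_inv in auto)
  moreover have "continuous_map (tetrahedra_topology n) (tetrahedra_topology n) unlabel_points"
    unfolding unlabel_points_def
    by (rule continuous_map_relabel_tetrahedra) (use inv_\<pi>_less s in auto)
  ultimately show ?thesis
    unfolding homeomorphic_maps_def topspace_tetrahedra_topology
    by (auto simp: relabel_points_def unlabel_points_def fun_eq_iff s_inverses inv_\<pi>_less)
qed

lemma glue_points_relabel:
  assumes "(u, v) \<in> glue_points n T p"
  shows "(relabel_points u, relabel_points v) \<in> glue_points n T' p'"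
proof -
  obtain i a x where uv: "u = (i, x)" "v = (T i a, x \<circ> inv_into UNIV (p i a))"
    and ia: "i < n" "a \<le> 3" "x \<in> truncated_tetrahedron" "x a = 0"
    using assms unfolding glue_points_def by auto
  have "x \<circ> inv_into UNIV (s i) \<in> truncated_tetrahedron"
    using truncated_tetrahedron_permute permutes_inv s ia by blast
  moreover have "(x \<circ> inv_into UNIV (s i)) (s i a) = 0"
    using ia by (simp add: s_inverses)
  moreover have "relabel_points v = (T' (\<pi> i) (s i a), (x \<circ> inv_into UNIV (s i)) \<circ> inv_into UNIV (p' (\<pi> i) (s i a)))"
    using ia uv by (auto simp: relabel_points_def relabel_tetrahedra_image inv_relabel_faces_image
        fun_eq_iff s_inverses)
  moreover have "relabel_points u = (\<pi> i, x \<circ> inv_into UNIV (s i))"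
    by (simp add: uv relabel_points_def)
  ultimately show ?thesis
    unfolding glue_points_def using ia \<pi>_less s_le by blast
qed

lemma glue_points_unlabel:
  assumes "(u, v) \<in> glue_points n T' p'"
  shows "(unlabel_points u, unlabel_points v) \<in> glue_points n T p"
proof -
  obtain j b x where "u = (j, x)" "v = (T' j b, x \<circ> inv_into UNIV (p' j b))"
    and "j < n" "b \<le> 3" and x: "x \<in> truncated_tetrahedron" "x b = 0"
    using assms unfolding glue_points_def by auto
  then obtain i a where uv: "u = (\<pi> i, x)" "v = (T' (\<pi> i) (s i a), x \<circ> inv_into UNIV (p' (\<pi> i) (s i a)))"
    and ia: "i < n" "a \<le> 3" and b: "b = s i a"
    using inv_\<pi>_less inv_s_le \<pi>_inverses(1) s_inverses(1) by metis
  have "x \<circ> s i \<in> truncated_tetrahedron" "(x \<circ> s i) a = 0"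
    using truncated_tetrahedron_permute s ia x b by auto
  moreover have "unlabel_points v = (T i a, (x \<circ> s i) \<circ> inv_into UNIV (p i a))"
    using ia uv by (auto simp: unlabel_points_def relabel_tetrahedra_image inv_relabel_faces_image
        fun_eq_iff s_inverses T_less)
  moreover have "unlabel_points u = (i, x \<circ> s i)"
    by (simp add: uv unlabel_points_def)
  ultimately show ?thesis
    unfolding glue_points_def using ia by blast
qed

text \<open>The space \<open>X\<close> itself stays; its quotient map is composed with the
  homeomorphism \<open>unlabel_points\<close>, under which the two gluing relations correspond in
  both directions.\<close>

lemma ideal_triangulation_relabelled:
  assumes "ideal_triangulation n T p X"
  shows "ideal_triangulation n T' p' X"
proof -
  let ?Z = "tetrahedra_topology n"
  obtain q where q: "quotient_map ?Z X q"
      "\<And>u v. u \<in> topspace ?Z \<Longrightarrow> v \<in> topspace ?Z \<Longrightarrow> q u = q v \<longleftrightarrow> (u, v) \<in> (glue_points n T p)\<^sup>*"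
    using assms unfolding ideal_triangulation_def by blast
  have "homeomorphic_map ?Z ?Z unlabel_points"
    using homeomorphic_maps_relabel_points homeomorphic_maps_imp_map by blast
  then have "quotient_map ?Z X (q \<circ> unlabel_points)"
    using q(1) quotient_map_compose unfolding homeomorphic_map_def by blast
  moreover have "(q \<circ> unlabel_points) u = (q \<circ> unlabel_points) v \<longleftrightarrow> (u, v) \<in> (glue_points n T' p')\<^sup>*"
    if uv: "u \<in> topspace ?Z" "v \<in> topspace ?Z" for u v
  proof -
    have "unlabel_points u \<in> topspace ?Z" "unlabel_points v \<in> topspace ?Z"
      and inverse: "relabel_points (unlabel_points u) = u" "relabel_points (unlabel_points v) = v"
      using homeomorphic_maps_relabel_points uv
      unfolding homeomorphic_maps_def continuous_map_def by auto
    then have "(q \<circ> unlabel_points) u = (q \<circ> unlabel_points) v \<longleftrightarrow>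
        (unlabel_points u, unlabel_points v) \<in> (glue_points n T p)\<^sup>*"
      using q(2) by simp
    also have "\<dots> \<longleftrightarrow> (u, v) \<in> (glue_points n T' p')\<^sup>*"
      using rtrancl_image[of "unlabel_points u" "unlabel_points v" "glue_points n T p" relabel_points
            "glue_points n T' p'"]
        rtrancl_image[of u v "glue_points n T' p'" unlabel_points "glue_points n T p"]
        glue_points_relabel glue_points_unlabel inverse by auto
    finally show ?thesis .
  qed
  ultimately show ?thesis
    unfolding ideal_triangulation_def using face_pairing_relabelled by blast
qed

end

section \<open>Counting gluings\<close>

definition adjacent_tetrahedra :: "nat \<Rightarrow> (nat \<Rightarrow> nat \<Rightarrow> nat) \<Rightarrow> nat rel" where
  "adjacent_tetrahedra n T = {(i, T i a) | i a. i < n \<and> a \<le> 3}"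

text \<open>Each tetrahedron has its edge \<open>{0, 1}\<close> in the only edge class, and a chain
  of edge gluings projects to a chain of adjacent tetrahedra.\<close>

lemma one_edge_connected:
  assumes one: "card (triangulation_edges n T p) = 1" and i: "i < n" and j: "j < n"
  shows "(i, j) \<in> (adjacent_tetrahedra n T)\<^sup>*"
proof -
  let ?R = "(glue_edges n T p)\<^sup>*"
  obtain E where E: "triangulation_edges n T p = {E}"
    using one card_1_singletonE by blast
  have "(k, {0, 1}) \<in> tetrahedra_edges n" if "k < n" for k
    using that by (simp add: tetrahedra_edges_def)
  then have "?R `` {(k, {0, 1})} = E" if "k < n" for k
    using E that unfolding triangulation_edges_def by (metis quotientI singletonD)
  then have "((i, {0, 1}), (j, {0, 1})) \<in> ?R"
    using i j by blast
  then have "(fst (i, {0, 1::nat}), fst (j, {0, 1::nat})) \<in> (adjacent_tetrahedra n T)\<^sup>*"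
    by (rule rtrancl_image) (auto simp: glue_edges_def tetrahedra_edges_def adjacent_tetrahedra_def)
  then show ?thesis by simp
qed

text \<open>Agreement spreads across faces: the old labels, the new labels on one side and the new
  gluing determine the new labels on the other side.\<close>

lemma relabelling_unique:
  assumes "relabelling n \<pi> s T p" "relabelling n \<pi>' s' T p"
    and eq: "\<And>i a. i < n \<Longrightarrow> a \<le> 3 \<Longrightarrow> relabel_tetrahedra \<pi> s T i a = relabel_tetrahedra \<pi>' s' T i a
      \<and> relabel_faces \<pi> s T p i a = relabel_faces \<pi>' s' T p i a"
    and start: "i < n" "\<pi> i = \<pi>' i" "s i = s' i"
    and path: "(i, j) \<in> (adjacent_tetrahedra n T)\<^sup>*"
  shows "j < n \<and> \<pi> j = \<pi>' j \<and> s j = s' j"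
  using path
proof induction
  case base
  then show ?case using start by simp
next
  case (step j k)
  interpret R: relabelling n \<pi> s T p by fact
  interpret R': relabelling n \<pi>' s' T p by fact
  obtain a where a: "k = T j a" "j < n" "a \<le> 3"
    using step.hyps(2) unfolding adjacent_tetrahedra_def by blast
  have j: "\<pi> j = \<pi>' j" "s j = s' j"
    using step.IH by auto
  have "R.T' (\<pi> j) (s j a) = R'.T' (\<pi> j) (s j a) \<and> R.p' (\<pi> j) (s j a) = R'.p' (\<pi> j) (s j a)"
    using eq a R.\<pi>_less R.s_le by blast
  then have T: "\<pi> k = \<pi>' k" and p: "s k \<circ> p j a \<circ> inv_into UNIV (s j) = s' k \<circ> p j a \<circ> inv_into UNIV (s j)"
    using a R.relabel_tetrahedra_image R'.relabel_tetrahedra_image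
      R.relabel_faces_image R'.relabel_faces_image by (metis j)+
  \<comment> \<open>The common right factor is onto and can be cancelled.\<close>
  have "surj (p j a \<circ> inv_into UNIV (s j))"
    using a R.p_permutes R.s permutes_inv permutes_surj by (metis comp_surj)
  then have "s k = s' k"
    using p by (metis comp_assoc surj_fun_eq[of _ UNIV] fun.set_map)
  then show ?case
    using T R.T_less a by simp
qed

text \<open>Composing with the transposition of \<open>a\<close> and \<open>b\<close> turns
  \<open>s a = b\<close> into \<open>s a = a\<close>, which leaves the permutations of
  \<open>A - {a}\<close>.\<close>

lemma card_permutations_moving:
  assumes "finite A" "a \<in> A" "b \<in> A"
  shows "card {s. s permutes A \<and> s a = b} = fact (card A - 1)"
proof -
  let ?t = "Transposition.transpose a b"
  have t: "?t permutes A"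
    using assms by (simp add: permutes_swap_id)
  have "bij_betw (\<lambda>s. ?t \<circ> s) {s. s permutes A - {a}} {s. s permutes A \<and> s a = b}"
  proof (rule bij_betw_byWitness[where f' = "\<lambda>s. ?t \<circ> s"])
    show "(\<lambda>s. ?t \<circ> s) ` {s. s permutes A - {a}} \<subseteq> {s. s permutes A \<and> s a = b}"
    proof (rule image_subsetI)
      fix s assume "s \<in> {s. s permutes A - {a}}"
      then have s: "s permutes A" "s a = a"
        using permutes_subset[of s "A - {a}" A] permutes_not_in[of s "A - {a}" a] by auto
      then show "?t \<circ> s \<in> {s. s permutes A \<and> s a = b}"
        using permutes_compose[OF s(1) t] by simp
    qed
    show "(\<lambda>s. ?t \<circ> s) ` {s. s permutes A \<and> s a = b} \<subseteq> {s. s permutes A - {a}}"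
    proof (rule image_subsetI)
      fix s assume "s \<in> {s. s permutes A \<and> s a = b}"
      then have s: "s permutes A" "s a = b"
        by auto
      then show "?t \<circ> s \<in> {s. s permutes A - {a}}"
        using permutes_superset[OF permutes_compose[OF s(1) t], of "A - {a}"] by auto
    qed
  qed (simp_all add: fun_eq_iff)
  then have "card {s. s permutes A \<and> s a = b} = card {s. s permutes A - {a}}"
    using bij_betw_same_card by fastforce
  also have "\<dots> = fact (card (A - {a}))"
    using assms by (intro card_permutations) auto
  finally show ?thesis
    using assms by simp
qed

section \<open>Upper bound for the labelled face pairings\<close>

text \<open>A gluing is encoded by \<open>f (i, a) = (T i a, p i a)\<close>; restricting it to an arbitrary set \<open>S\<close> of
  faces makes the count an induction that removes two glued faces at a time.\<close>

definition pairings :: "(nat \<times> nat) set \<Rightarrow> (nat \<times> nat \<Rightarrow> nat \<times> (nat \<Rightarrow> nat)) set" where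
  "pairings S = {f \<in> extensional S. \<forall>i a. (i, a) \<in> S \<longrightarrow> (case f (i, a) of (j, s) \<Rightarrow>
     s permutes {..3} \<and> (j, s a) \<in> S \<and> (j, s a) \<noteq> (i, a) \<and> f (j, s a) = (i, inv_into UNIV s))}"

text \<open>Gluing is an involution on faces, so no other face is glued to either of the two removed
  ones. The last three claims let \<open>f\<close> be recovered from its restriction and the pair
  \<open>(j, s)\<close>.\<close>

lemma pairings_remove:
  assumes f: "f \<in> pairings S" and x: "(i, a) \<in> S" and fx: "f (i, a) = (j, s)"
  shows "restrict f (S - {(i, a), (j, s a)}) \<in> pairings (S - {(i, a), (j, s a)})"
    "(j, s a) \<in> S - {(i, a)}" "s permutes {..3}" "f (j, s a) = (i, inv_into UNIV s)" 
proof -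
  have *: "\<And>i a j s. (i, a) \<in> S \<Longrightarrow> f (i, a) = (j, s) \<Longrightarrow> s permutes {..3} \<and> (j, s a) \<in> S \<and>
      (j, s a) \<noteq> (i, a) \<and> f (j, s a) = (i, inv_into UNIV s)"
    using f unfolding pairings_def by fastforce
  show "(j, s a) \<in> S - {(i, a)}" "s permutes {..3}" and y: "f (j, s a) = (i, inv_into UNIV s)"
    using *[OF x fx] by auto
  have inv: "inv_into UNIV s (s a) = a"
    using permutes_inverses(2)[of s "{..3}" a] *[OF x fx] by blast
  have "(k, t b) \<noteq> (i, a) \<and> (k, t b) \<noteq> (j, s a)"
    if "(l, b) \<in> S" "(l, b) \<noteq> (i, a)" "(l, b) \<noteq> (j, s a)" "f (l, b) = (k, t)" for l b k t
  proof -
    have t: "t permutes {..3}" "f (k, t b) = (l, inv_into UNIV t)"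
      using *[OF that(1,4)] by auto
    have b: "inv_into UNIV t (t b) = b"
      using permutes_inverses t(1) by metis
    show ?thesis
    proof (intro conjI notI)
      assume "(k, t b) = (i, a)"
      then show False using t(2) b fx that(3) by auto
    next
      assume "(k, t b) = (j, s a)"
      then show False using t(2) b y inv that(2) by auto
    qed
  qed
  then show "restrict f (S - {(i, a), (j, s a)}) \<in> pairings (S - {(i, a), (j, s a)})"
    using * unfolding pairings_def by (auto split: prod.splits)
qed

text \<open>A chosen face has \<open>2 * k + 1\<close> possible partners when
  \<open>2 * (k + 1)\<close> faces are present. For each partner \<open>3!\<close> permutations
  carry the index of the face to that of the partner. The product of odd numbers is the double
  factorial \<open>(2 k - 1)!!\<close>.\<close>

lemma card_pairings:
  assumes "finite S" "snd ` S \<subseteq> {..3}" "card S = 2 * k"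
  shows "finite (pairings S) \<and> card (pairings S) \<le> 6 ^ k * (\<Prod>j<k. 2 * j + 1)"
  using assms
proof (induction k arbitrary: S)
  case 0
  then have "S = {}"
    by (metis card_0_eq mult_0_right)
  then have "pairings S \<subseteq> {\<lambda>_. undefined}"
    unfolding pairings_def by (simp add: extensional_empty)
  then show ?case
    using finite_subset[of "pairings S" "{\<lambda>_. undefined}"] card_mono[of "{\<lambda>_. undefined}" "pairings S"]
    by simp
next
  case (Suc k)
  have "S \<noteq> {}"
    using Suc.prems(3) by auto
  then obtain x where x: "x \<in> S" by blast
  obtain i a where ia: "x = (i, a)" by force
  let ?P = "\<lambda>y. {s. s permutes {..3::nat} \<and> s a = snd y} \<times> pairings (S - {x, y})"
  let ?U = "SIGMA y : S - {x}. ?P y"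
  \<comment> \<open>The value at the partner \<open>y\<close> is not recorded, since it is forced to
    be the inverse gluing.\<close>
  define enc where "enc f = (let (j, s) = f x; y = (j, s a) in (y, s, restrict f (S - {x, y})))"
    for f :: "nat \<times> nat \<Rightarrow> nat \<times> (nat \<Rightarrow> nat)"
  have P: "finite (?P y) \<and> card (?P y) \<le> 6 * (6 ^ k * (\<Prod>j<k. 2 * j + 1))" if y: "y \<in> S - {x}" for y
  proof -
    have "card (S - {x, y}) = 2 * k"
      using Suc.prems x y by (auto simp: card_Diff_subset card_insert_if)
    then have IH: "finite (pairings (S - {x, y}))"
        "card (pairings (S - {x, y})) \<le> 6 ^ k * (\<Prod>j<k. 2 * j + 1)"
      using Suc.IH[of "S - {x, y}"] Suc.prems by auto
    have "a \<in> {..3}" "snd y \<in> {..3}"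
      using Suc.prems(2) x y ia by (force simp: image_subset_iff)+
    then have "card {s. s permutes {..3::nat} \<and> s a = snd y} = 6"
      using card_permutations_moving[of "{..3::nat}" a "snd y"] by (simp add: fact_numeral)
    moreover have "finite {s. s permutes {..3::nat} \<and> s a = snd y}"
      using finite_permutations[of "{..3::nat}"] by (rule rev_finite_subset) auto
    ultimately show ?thesis
      using IH by (simp add: card_cartesian_product)
  qed
  have sub: "enc ` pairings S \<subseteq> ?U"
  proof (rule image_subsetI)
    fix f assume f: "f \<in> pairings S"
    obtain j s where fx: "f x = (j, s)" by force
    show "enc f \<in> ?U"
      using pairings_remove[of f S i a j s] f fx x ia by (simp add: enc_def Let_def)
  qed
  have inj: "inj_on enc (pairings S)"
  proof (rule inj_onI)
    fix f g assume fg: "f \<in> pairings S" "g \<in> pairings S" "enc f = enc g"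
    obtain j s where fx: "f x = (j, s)" by force
    have gx: "g x = (j, s)"
      using fg(3) fx by (auto simp: enc_def Let_def split: prod.splits)
    have r: "restrict f (S - {x, (j, s a)}) = restrict g (S - {x, (j, s a)})"
      using fg(3) fx gx by (auto simp: enc_def Let_def)
    have "f (j, s a) = g (j, s a)"
      using pairings_remove(4)[of _ S i a j s] fg fx gx x ia by metis
    then have "f z = g z" if "z \<in> S" for z
      using that fx gx fun_cong[OF r, of z] by (cases "z = x \<or> z = (j, s a)") auto
    then show "f = g"
      using fg by (intro extensionalityI[of f S g]) (auto simp: pairings_def)
  qed
  have fin: "finite ?U"
    by (rule finite_SigmaI[OF finite_Diff[OF Suc.prems(1)] P[THEN conjunct1]])
  have "finite (pairings S)"
    using inj sub fin by (rule inj_on_finite)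
  moreover have "card (pairings S) \<le> card ?U"
    using inj sub fin by (rule card_inj_on_le)
  moreover have "card ?U = (\<Sum>y\<in>S - {x}. card (?P y))"
    by (rule card_SigmaI[OF finite_Diff[OF Suc.prems(1)]]) (rule ballI, rule P[THEN conjunct1])
  moreover have "\<dots> \<le> (\<Sum>y\<in>S - {x}. 6 * (6 ^ k * (\<Prod>j<k. 2 * j + 1)))"
    using P by (intro sum_mono) blast
  moreover have "card (S - {x}) = 2 * k + 1"
    using Suc.prems x by simp
  ultimately show ?case
    by (simp add: algebra_simps)
qed

section \<open>The labelled gluings that realize one manifold\<close>

definition pairing_code ::
    "nat \<Rightarrow> (nat \<Rightarrow> nat \<Rightarrow> nat) \<Rightarrow> (nat \<Rightarrow> nat \<Rightarrow> nat \<Rightarrow> nat) \<Rightarrow> nat \<times> nat \<Rightarrow> nat \<times> (nat \<Rightarrow> nat)" where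
  "pairing_code n T p = restrict (\<lambda>(i, a). (T i a, p i a)) ({..<n} \<times> {..3})"

text \<open>Restriction to the existing faces erases the arbitrary values, so a code is the gluing
  itself.\<close>

lemma pairing_code_eq_iff:
  "pairing_code n T p = pairing_code n T' p' \<longleftrightarrow>
    (\<forall>i<n. \<forall>a\<le>3. T i a = T' i a \<and> p i a = p' i a)"
  unfolding pairing_code_def restrict_def fun_eq_iff[of "\<lambda>x. if x \<in> _ then _ x else _"] by auto

lemma pairing_code_in_pairings:
  assumes "face_pairing n T p"
  shows "pairing_code n T p \<in> pairings ({..<n} \<times> {..3})"
proof -
  have "p i a a \<le> 3" if "i < n" "a \<le> 3" for i a
    using assms that permutes_in_image[of "p i a" "{..3}" a] unfolding face_pairing_def by auto
  then show ?thesis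
    using assms unfolding face_pairing_def pairings_def pairing_code_def by auto
qed

definition ideal_triangulation_codes ::
    "nat \<Rightarrow> 'a topology \<Rightarrow> (nat \<times> nat \<Rightarrow> nat \<times> (nat \<Rightarrow> nat)) set" where
  "ideal_triangulation_codes n X = {pairing_code n T p | T p. ideal_triangulation n T p X}"

lemma ideal_triangulation_codes_subset:
  "ideal_triangulation_codes n X \<subseteq> pairings ({..<n} \<times> {..3})"
  unfolding ideal_triangulation_codes_def ideal_triangulation_def
  using pairing_code_in_pairings by blast

text \<open>This makes the code sets of different homeomorphism classes disjoint.\<close>

lemma ideal_triangulation_codes_homeomorphic:
  assumes "c \<in> ideal_triangulation_codes n X" "c \<in> ideal_triangulation_codes n Y"
  shows "X homeomorphic_space Y"
proof -
  obtain T p T' p' where X: "c = pairing_code n T p" "ideal_triangulation n T p X"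
    and Y: "c = pairing_code n T' p'" "ideal_triangulation n T' p' Y"
    using assms unfolding ideal_triangulation_codes_def by blast
  then have "\<forall>i<n. \<forall>a\<le>3. T i a = T' i a \<and> p i a = p' i a"
    using pairing_code_eq_iff by metis
  then show ?thesis
    by (intro ideal_triangulation_homeomorphic[OF X(2) Y(2)]) blast
qed

text \<open>The \<open>4 n\<close> faces form \<open>2 n\<close> pairs, and
  \<open>6 ^ (2 * n)\<close> is \<open>36 ^ n\<close>.\<close>

lemma card_finite_pairings:
  "finite (pairings ({..<n} \<times> {..3})) \<and>
    card (pairings ({..<n} \<times> {..3})) \<le> 36 ^ n * (\<Prod>j<2 * n. 2 * j + 1)"
  using card_pairings[of "{..<n} \<times> {..3}" "2 * n"]
  by (auto simp: card_cartesian_product power_mult)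

text \<open>All relabellings of the given gluing realize \<open>X\<close>; by rigidity, those that
  fix the labelled tetrahedron \<open>0\<close> have different codes.\<close>

lemma card_ideal_triangulation_codes:
  assumes tri: "ideal_triangulation n T p X" and one: "card (triangulation_edges n T p) = 1"
    and n: "n > 0"
  shows "fact (n - 1) * 24 ^ (n - 1) \<le> card (ideal_triangulation_codes n X)"
proof -
  \<comment> \<open>Tetrahedron \<open>0\<close> and its vertices keep their labels, the common
    start that \<open>relabelling_unique\<close> asks for. Extensionality makes \<open>s\<close>
    determined by its values below \<open>n\<close>.\<close>
  let ?S = "\<lambda>i. if i = 0 then {id} else {s. s permutes {..3::nat}}"
  let ?L = "{\<pi>. \<pi> permutes {1..<n}} \<times> (\<Pi>\<^sub>E i\<in>{..<n}. ?S i)"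
  define enc where
    "enc = (\<lambda>(\<pi>, s). pairing_code n (relabel_tetrahedra \<pi> s T) (relabel_faces \<pi> s T p))"
  have "card (\<Pi>\<^sub>E i\<in>{..<n}. ?S i) = (\<Prod>i<n. if i = 0 then 1 else 24)"
    by (subst card_PiE) (auto simp: card_permutations fact_numeral intro!: prod.cong)
  also have "\<dots> = 24 ^ (n - 1)"
  proof -
    have "(\<Prod>i<n. if i = 0 then 1 else 24) = (\<Prod>i\<in>{1..<n}. 24 :: nat)"
      by (rule prod.mono_neutral_cong_right) auto
    then show ?thesis by simp
  qed
  finally have card: "card ?L = fact (n - 1) * 24 ^ (n - 1)"
    by (simp add: card_cartesian_product card_permutations)
  have R: "relabelling n \<pi> s T p" and zero: "\<pi> 0 = 0" "s 0 = id" if "(\<pi>, s) \<in> ?L" for \<pi> s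
  proof -
    have "\<pi> permutes {..<n}"
      using that by (auto intro: permutes_subset)
    moreover have "s i permutes {..3}" if "i < n" for i
      using PiE_mem[of s "{..<n}" ?S i] \<open>(\<pi>, s) \<in> ?L\<close> that by (auto split: if_splits)
    ultimately show "relabelling n \<pi> s T p"
      using tri unfolding relabelling_def ideal_triangulation_def by blast
    show "\<pi> 0 = 0"
      using that permutes_not_in[of \<pi> "{1..<n}" 0] by auto
    show "s 0 = id"
      using that PiE_mem[of s "{..<n}" ?S 0] n by auto
  qed
  have "inj_on enc ?L"
  proof (rule inj_onI, clarify)
    fix \<pi> s \<pi>' s'
    assume \<pi>: "\<pi> permutes {1..<n}" "\<pi>' permutes {1..<n}"
      and s: "s \<in> (\<Pi>\<^sub>E i\<in>{..<n}. ?S i)" "s' \<in> (\<Pi>\<^sub>E i\<in>{..<n}. ?S i)"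
      and enc: "enc (\<pi>, s) = enc (\<pi>', s')"
    have L: "(\<pi>, s) \<in> ?L" "(\<pi>', s') \<in> ?L"
      using \<pi> s by auto
    have eq: "\<pi> j = \<pi>' j \<and> s j = s' j" if "j < n" for j
      using relabelling_unique[OF R[OF L(1)] R[OF L(2)], of 0 j] enc n zero[OF L(1)] zero[OF L(2)]
        one_edge_connected[OF one n that]
      unfolding enc_def prod.case pairing_code_eq_iff by auto
    have "\<pi> j = \<pi>' j" for j
      using eq permutes_not_in[OF \<pi>(1)] permutes_not_in[OF \<pi>(2)] by (cases "j < n") auto
    moreover have "s = s'"
      using eq by (intro PiE_ext[OF s]) auto
    ultimately show "\<pi> = \<pi>' \<and> s = s'"
      by auto
  qed
  moreover have "enc ` ?L \<subseteq> ideal_triangulation_codes n X"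
    using relabelling.ideal_triangulation_relabelled[OF R tri]
    unfolding enc_def ideal_triangulation_codes_def by auto
  moreover have "finite (ideal_triangulation_codes n X)"
    using ideal_triangulation_codes_subset card_finite_pairings finite_subset by blast
  ultimately have "card ?L \<le> card (ideal_triangulation_codes n X)"
    by (rule card_inj_on_le)
  then show ?thesis
    using card by simp
qed

section \<open>Double counting of manifolds and gluings\<close>

lemma card_times_le_of_disjoint_family:
  assumes U: "finite U" and F: "\<And>c. c \<in> C \<Longrightarrow> F c \<subseteq> U" "\<And>c. c \<in> C \<Longrightarrow> k \<le> card (F c)"
    and disj: "\<And>c d. c \<in> C \<Longrightarrow> d \<in> C \<Longrightarrow> c \<noteq> d \<Longrightarrow> F c \<inter> F d = {}" and k: "k > 0"
  shows "finite C \<and> card C * k \<le> card U"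
proof
  \<comment> \<open>As \<open>k > 0\<close>, the sets \<open>F c\<close> are nonempty, so disjoint
    ones differ. Thus \<open>C\<close> embeds into the power set of \<open>U\<close> and is
    finite.\<close>
  have "inj_on F C"
    using disj F(2) k by (intro inj_onI) (metis card.empty inf.idem leD)
  moreover have "F ` C \<subseteq> Pow U"
    using F by blast
  ultimately show fin: "finite C"
    using U by (meson finite_Pow_iff finite_imageD finite_subset)
  have "card C * k \<le> (\<Sum>c\<in>C. card (F c))"
    using sum_bounded_below[of C k "\<lambda>c. card (F c)"] F(2) by simp
  also have "\<dots> = card (\<Union>c\<in>C. F c)"
    using fin U F disj by (subst card_UN_disjoint) (auto intro: finite_subset)
  also have "\<dots> \<le> card U"
    using U F by (intro card_mono) auto
  finally show "card C * k \<le> card U" .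
qed

lemma card_manifold_classes_times:
  fixes n :: nat
  assumes n: "n > 0"
  shows "finite (manifold_classes n :: 'a topology set set) \<and>
    card (manifold_classes n :: 'a topology set set) * (fact (n - 1) * 24 ^ (n - 1))
      \<le> 36 ^ n * (\<Prod>j<2 * n. 2 * j + 1)"
proof -
  let ?R = "{(X, Y :: 'a topology). X homeomorphic_space Y}"
  let ?U = "pairings ({..<n} \<times> {..3})"
  \<comment> \<open>The classes in \<open>manifold_classes\<close> come from the homeomorphism
    relation on all topologies over the type, hence \<open>UNIV\<close>.\<close>
  have equiv: "equiv UNIV ?R"
  proof (rule equivI)
    show "sym ?R"
      unfolding sym_def using homeomorphic_space_sym by blast
    show "trans ?R"
      unfolding trans_def using homeomorphic_space_trans by blast
  qed (auto simp: refl_on_def homeomorphic_space_refl)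
  have quotient: "manifold_classes n \<subseteq> UNIV // ?R"
    unfolding manifold_classes_def quotient_def by blast
  have "finite (manifold_classes n :: 'a topology set set) \<and>
      card (manifold_classes n :: 'a topology set set) * (fact (n - 1) * 24 ^ (n - 1)) \<le> card ?U"
  proof (rule card_times_le_of_disjoint_family[where F = "\<lambda>c. \<Union>X\<in>c. ideal_triangulation_codes n X"])
    show fin: "finite ?U"
      using card_finite_pairings by blast
    show sub: "(\<Union>X\<in>c. ideal_triangulation_codes n X) \<subseteq> ?U" for c :: "'a topology set"
      using ideal_triangulation_codes_subset by blast
    show "fact (n - 1) * 24 ^ (n - 1) \<le> card (\<Union>X\<in>c. ideal_triangulation_codes n X)"
      if c: "c \<in> manifold_classes n" for c :: "'a topology set"
    proof -
      obtain X where "X \<in> c" "one_edge_manifold n X"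
        using c homeomorphic_space_refl unfolding manifold_classes_def quotient_def by fastforce
      then have "fact (n - 1) * 24 ^ (n - 1) \<le> card (ideal_triangulation_codes n X)"
        using card_ideal_triangulation_codes n unfolding one_edge_manifold_def by blast
      also have "\<dots> \<le> card (\<Union>X\<in>c. ideal_triangulation_codes n X)"
        using \<open>X \<in> c\<close> finite_subset[OF sub fin] by (intro card_mono) auto
      finally show ?thesis .
    qed
    show "(\<Union>X\<in>c. ideal_triangulation_codes n X) \<inter> (\<Union>X\<in>d. ideal_triangulation_codes n X) = {}"
      if "c \<in> manifold_classes n" "d \<in> manifold_classes n" "c \<noteq> d" for c d :: "'a topology set"
      using quotient_eq_iff[OF equiv] ideal_triangulation_codes_homeomorphic quotient that by blast
  qed simp
  then show ?thesis
    using card_finite_pairings[of n] le_trans by blast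
qed

text \<open>The induction adds two odd factors at a time, \<open>4 n + 1\<close> and
  \<open>4 n + 3\<close>, each at most \<open>4 (n + 1)\<close>.\<close>

lemma prod_odd_le: "(\<Prod>j<2 * n. 2 * j + 1) \<le> 16 ^ n * (fact n)\<^sup>2" for n :: nat
proof (induction n)
  case (Suc n)
  have "(\<Prod>j<2 * Suc n. 2 * j + 1) = (\<Prod>j<2 * n. 2 * j + 1) * ((4 * n + 1) * (4 * n + 3))"
    by (simp add: algebra_simps)
  also have "\<dots> \<le> (16 ^ n * (fact n)\<^sup>2) * (16 * (n + 1)\<^sup>2)"
  proof (rule mult_le_mono[OF Suc.IH])
    show "(4 * n + 1) * (4 * n + 3) \<le> 16 * (n + 1)\<^sup>2"
      by (simp add: power2_eq_square algebra_simps)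
  qed
  also have "\<dots> = 16 ^ Suc n * (fact (Suc n))\<^sup>2"
    by (simp add: power2_eq_square algebra_simps)
  finally show ?case .
qed simp

lemma card_manifold_classes:
  fixes n :: nat
  assumes n: "n > 0"
  shows "finite (manifold_classes n :: 'a topology set set) \<and>
    card (manifold_classes n :: 'a topology set set) \<le> 24 * n * 24 ^ n * fact n"
proof -
  let ?M = "manifold_classes n :: 'a topology set set"
  let ?k = "fact (n - 1) * 24 ^ (n - 1) :: nat"
  obtain m where m: "n = Suc m"
    using n gr0_implies_Suc by blast
  have "card ?M * ?k \<le> 36 ^ n * (16 ^ n * (fact n)\<^sup>2)"
    using card_manifold_classes_times[OF n, where 'a = 'a] prod_odd_le[of n]
    by (meson le_trans mult_le_mono2)
  \<comment> \<open>Here \<open>36 * 16 = 24 * 24\<close>; one of the powers then cancels against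
    \<open>24 ^ (n - 1)\<close> and one factorial against \<open>fact (n - 1)\<close>, leaving
    \<open>24 * n\<close>.\<close>
  also have "\<dots> = 24 ^ n * 24 ^ n * (fact n)\<^sup>2"
    by (simp flip: power_mult_distrib)
  also have "\<dots> = (24 * n * 24 ^ n * fact n) * ?k"
    by (simp add: m power2_eq_square algebra_simps)
  finally have "card ?M \<le> 24 * n * 24 ^ n * fact n"
    by (simp only: mult_le_cancel2) simp
  then show ?thesis
    using card_manifold_classes_times[OF n] by blast
qed

section \<open>Isomorphism classes of 4-regular graphs\<close>

lemma digraph_iso_with_proj_refl:
  assumes "pair_wf_digraph G"
  shows "digraph_iso (with_proj G) (with_proj G)"
  unfolding digraph_iso_def
proof (intro exI conjI)
  let ?f = "\<lparr>iso_verts = id, iso_arcs = id, iso_head = snd, iso_tail = fst\<rparr>"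
  show "pre_digraph.digraph_isomorphism (with_proj G) ?f"
    using assms by (simp add: pre_digraph.digraph_isomorphism_def wf_digraph_wp_iff)
  show "with_proj G = app_iso ?f (with_proj G)"
    by (simp add: app_iso_def with_proj_def)
qed

text \<open>Arcs are pairs with \<open>fst\<close> and \<open>snd\<close> as tail and head on both
  sides, so the map on arcs is forced by the map on vertices.\<close>

lemma digraph_iso_with_projE:
  assumes "digraph_iso (with_proj G) (with_proj H)"
  obtains \<psi> where "inj_on \<psi> (pverts G)" "pverts H = \<psi> ` pverts G"
    "parcs H = (\<lambda>(u, v). (\<psi> u, \<psi> v)) ` parcs G"
proof -
  obtain f where f: "pre_digraph.digraph_isomorphism (with_proj G) f" "with_proj H = app_iso f (with_proj G)"
    using assms unfolding digraph_iso_def by blast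
  have tail: "iso_tail f = fst" and head: "iso_head f = snd"
    using arg_cong[OF f(2), of tail] arg_cong[OF f(2), of head] by simp_all
  have arcs: "iso_arcs f e = (case e of (u, v) \<Rightarrow> (iso_verts f u, iso_verts f v))" if "e \<in> parcs G" for e
    using f(1) that unfolding pre_digraph.digraph_isomorphism_def
    by (auto simp: tail head prod_eq_iff split: prod.split)
  show thesis
  proof
    show "inj_on (iso_verts f) (pverts G)"
      using f(1) unfolding pre_digraph.digraph_isomorphism_def by simp
    show "pverts H = iso_verts f ` pverts G"
      using arg_cong[OF f(2), of verts] by simp
    show "parcs H = (\<lambda>(u, v). (iso_verts f u, iso_verts f v)) ` parcs G"
      using arg_cong[OF f(2), of arcs] image_cong[OF refl arcs] by simp
  qed
qed

lemma connected_simple_4_regular_wf: "connected_simple_4_regular G \<Longrightarrow> pair_wf_digraph G"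
  unfolding connected_simple_4_regular_def
  using pair_graph.axioms(1) pair_digraph.pair_wf_digraph by blast

lemma card_out_neighbours:
  assumes "connected_simple_4_regular G" "u \<in> pverts G"
  shows "card {v. (u, v) \<in> parcs G} = 4"
proof -
  have "out_arcs (with_proj G) u = Pair u ` {v. (u, v) \<in> parcs G}"
    by (auto simp: out_arcs_def)
  then have "card {v. (u, v) \<in> parcs G} = out_degree (with_proj G) u"
    unfolding out_degree_def by (simp add: card_image inj_on_def)
  then show ?thesis
    using assms unfolding connected_simple_4_regular_def by simp
qed

text \<open>The index \<open>k\<close> counts vertices, not arcs, and vertices may repeat.\<close>

definition walks :: "nat pair_pre_digraph \<Rightarrow> nat \<Rightarrow> (nat \<Rightarrow> nat) set" where
  "walks G k = {f \<in> {..<k} \<rightarrow>\<^sub>E pverts G. \<forall>i. Suc i < k \<longrightarrow> (f i, f (Suc i)) \<in> parcs G}"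

text \<open>The first vertex is free, and each later one is among the \<open>4\<close> neighbours of
  its predecessor.\<close>

lemma card_walks:
  assumes G: "connected_simple_4_regular G" and fin: "finite (pverts G)"
  shows "finite (walks G (Suc k)) \<and> card (walks G (Suc k)) \<le> card (pverts G) * 4 ^ k"
proof (induction k)
  case 0
  have "walks G (Suc 0) = {..<Suc 0} \<rightarrow>\<^sub>E pverts G"
    by (auto simp: walks_def)
  then show ?case
    using fin by (simp add: card_PiE finite_PiE)
next
  case (Suc k)
  let ?U = "SIGMA g : walks G (Suc k). {v. (g k, v) \<in> parcs G}"
  let ?enc = "\<lambda>f. (restrict f {..<Suc k}, f (Suc k))"
  have four: "finite {v. (g k, v) \<in> parcs G} \<and> card {v. (g k, v) \<in> parcs G} = 4"
    if "g \<in> walks G (Suc k)" for g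
  proof -
    have "g k \<in> pverts G"
      using that unfolding walks_def by auto
    then have "card {v. (g k, v) \<in> parcs G} = 4"
      by (rule card_out_neighbours[OF G])
    then show ?thesis
      using card.infinite by fastforce
  qed
  have "?enc ` walks G (Suc (Suc k)) \<subseteq> ?U"
    unfolding walks_def by (auto simp: PiE_iff)
  moreover have "inj_on ?enc (walks G (Suc (Suc k)))"
  proof (rule inj_onI)
    fix f g assume fg: "f \<in> walks G (Suc (Suc k))" "g \<in> walks G (Suc (Suc k))" "?enc f = ?enc g"
    then have r: "restrict f {..<Suc k} = restrict g {..<Suc k}" and last: "f (Suc k) = g (Suc k)"
      by auto
    have "f i = g i" if "i < Suc (Suc k)" for i
      using last fun_cong[OF r, of i] that by (cases "i = Suc k") auto
    then show "f = g"
      using fg(1,2) unfolding walks_def by (intro extensionalityI[of f "{..<Suc (Suc k)}" g]) (auto simp: PiE_iff)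
  qed
  moreover have "finite ?U"
    using Suc.IH four by (intro finite_SigmaI) auto
  ultimately have "finite (walks G (Suc (Suc k)))" "card (walks G (Suc (Suc k))) \<le> card ?U"
    using inj_on_finite card_inj_on_le by blast+
  moreover have "card ?U = (\<Sum>g\<in>walks G (Suc k). card {v. (g k, v) \<in> parcs G})"
    using Suc.IH four by (intro card_SigmaI) auto
  moreover have "\<dots> = card (walks G (Suc k)) * 4"
    using four by simp
  ultimately show ?case
    using Suc.IH by simp
qed

lemma finite_graph_classes: "finite (graph_classes n)"
proof -
  have "{G. connected_simple_4_regular G \<and> pverts G = {..<n}} \<subseteq>
      (\<lambda>A. \<lparr>pverts = {..<n}, parcs = A\<rparr>) ` Pow ({..<n} \<times> {..<n})"
  proof clarify
    fix G assume G: "connected_simple_4_regular G" "pverts G = {..<n}"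
    then interpret pair_wf_digraph G
      by (intro connected_simple_4_regular_wf)
    have "parcs G \<subseteq> {..<n} \<times> {..<n}"
      using in_arcsD1 in_arcsD2 G(2) by auto
    moreover have "G = \<lparr>pverts = {..<n}, parcs = parcs G\<rparr>"
      using G(2) by simp
    ultimately show "G \<in> (\<lambda>A. \<lparr>pverts = {..<n}, parcs = A\<rparr>) ` Pow ({..<n} \<times> {..<n})"
      by blast
  qed
  then have "finite {G. connected_simple_4_regular G \<and> pverts G = {..<n}}"
    by (rule finite_subset) simp
  then show ?thesis
    unfolding graph_classes_def quotient_def by simp
qed

text \<open>An isomorphism to the representative \<open>R\<close> of a class maps the Hamiltonian path
  \<open>0, 1, \<dots>, n - 1\<close> to a walk in \<open>R\<close>, and this walk determines the graph.\<close>

lemma card_path_graphs_le: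
  assumes \<G>: "\<And>G. G \<in> \<G> \<Longrightarrow> connected_simple_4_regular G \<and> pverts G = {..<n} \<and>
      (\<forall>u. Suc u < n \<longrightarrow> (u, Suc u) \<in> parcs G)" and n: "n > 0"
  shows "card \<G> \<le> card (graph_classes n) * (n * 4 ^ (n - 1))"
proof -
  let ?I = "{(G, H). digraph_iso (with_proj G) (with_proj (H :: nat pair_pre_digraph))}"
  \<comment> \<open>A class also contains isomorphic graphs on other vertex sets; reflexivity
    supplies a member on \<open>{..<n}\<close>.\<close>
  have "\<exists>R. R \<in> c \<and> connected_simple_4_regular R \<and> pverts R = {..<n}" if "c \<in> graph_classes n" for c
    using that digraph_iso_with_proj_refl connected_simple_4_regular_wf
    unfolding graph_classes_def quotient_def by blast
  then obtain R where R: "\<And>c. c \<in> graph_classes n \<Longrightarrow>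
      R c \<in> c \<and> connected_simple_4_regular (R c) \<and> pverts (R c) = {..<n}"
    by metis
  define cls where "cls G = ?I `` {G}" for G :: "nat pair_pre_digraph"
  have cls: "cls G \<in> graph_classes n" if "G \<in> \<G>" for G
    using \<G>[OF that] unfolding cls_def graph_classes_def by (intro quotientI) simp
  have "\<exists>\<psi>. inj_on \<psi> {..<n} \<and> {..<n} = \<psi> ` {..<n} \<and>
      parcs (R (cls G)) = (\<lambda>(u, v). (\<psi> u, \<psi> v)) ` parcs G" if G: "G \<in> \<G>" for G
  proof -
    have "digraph_iso (with_proj G) (with_proj (R (cls G)))"
      using R[OF cls[OF G]] unfolding cls_def by simp
    then show ?thesis
      using R[OF cls[OF G]] \<G>[OF G] digraph_iso_with_projE[of G "R (cls G)"] by metis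
  qed
  then obtain \<psi> where \<psi>: "\<And>G. G \<in> \<G> \<Longrightarrow> inj_on (\<psi> G) {..<n} \<and> {..<n} = \<psi> G ` {..<n} \<and>
      parcs (R (cls G)) = (\<lambda>(u, v). (\<psi> G u, \<psi> G v)) ` parcs G"
    by metis
  let ?enc = "\<lambda>G. (cls G, restrict (\<psi> G) {..<n})"
  let ?U = "SIGMA c : graph_classes n. walks (R c) n"
  have walks: "finite (walks (R c) n) \<and> card (walks (R c) n) \<le> n * 4 ^ (n - 1)"
    if "c \<in> graph_classes n" for c
    using card_walks[of "R c" "n - 1"] R[OF that] n by simp
  \<comment> \<open>Since \<open>\<psi> G\<close> is injective, the arcs of \<open>G\<close> can be
    pulled back from the representative, so class and walk together recover
    \<open>G\<close>.\<close>
  have arcs: "parcs G = {(u, v). u < n \<and> v < n \<and> (\<psi> G u, \<psi> G v) \<in> parcs (R (cls G))}" if G: "G \<in> \<G>" for G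
  proof -
    interpret pair_wf_digraph G
      using \<G>[OF G] by (intro connected_simple_4_regular_wf) simp
    have less: "u < n \<and> v < n" if "(u, v) \<in> parcs G" for u v
      using in_arcsD1[OF that] in_arcsD2[OF that] \<G>[OF G] by simp
    have "(u, v) \<in> parcs G" if uv: "u < n" "v < n" "(\<psi> G u, \<psi> G v) \<in> parcs (R (cls G))" for u v
    proof -
      obtain u' v' where e: "(u', v') \<in> parcs G" "\<psi> G u = \<psi> G u'" "\<psi> G v = \<psi> G v'"
        using uv(3) \<psi>[OF G] by auto
      then have "u = u'" "v = v'"
        using uv less[OF e(1)] \<psi>[OF G] by (auto dest: inj_onD)
      then show ?thesis using e(1) by simp
    qed
    moreover have "(\<psi> G u, \<psi> G v) \<in> parcs (R (cls G))" if "(u, v) \<in> parcs G" for u v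
      using \<psi>[OF G] that by auto
    ultimately have "(u, v) \<in> parcs G \<longleftrightarrow> u < n \<and> v < n \<and> (\<psi> G u, \<psi> G v) \<in> parcs (R (cls G))" for u v
      using less by blast
    then show ?thesis by auto
  qed
  have "inj_on ?enc \<G>"
  proof (rule inj_onI)
    fix G H assume GH: "G \<in> \<G>" "H \<in> \<G>" "?enc G = ?enc H"
    then have c: "cls G = cls H" and r: "restrict (\<psi> G) {..<n} = restrict (\<psi> H) {..<n}"
      by auto
    have "\<psi> G u = \<psi> H u" if "u < n" for u
      using fun_cong[OF r, of u] that by simp
    then have "parcs G = parcs H"
      using arcs[OF GH(1)] arcs[OF GH(2)] c by auto
    then show "G = H"
      using \<G>[OF GH(1)] \<G>[OF GH(2)] by simp
  qed
  moreover have "?enc ` \<G> \<subseteq> ?U"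
  proof (rule image_subsetI)
    fix G assume G: "G \<in> \<G>"
    have "\<psi> G u < n" if "u < n" for u
      using \<psi>[OF G] that by blast
    moreover have "(\<psi> G u, \<psi> G (Suc u)) \<in> parcs (R (cls G))" if "Suc u < n" for u
      using \<psi>[OF G] \<G>[OF G] that by auto
    ultimately have "restrict (\<psi> G) {..<n} \<in> walks (R (cls G)) n"
      using R[OF cls[OF G]] unfolding walks_def by auto
    then show "?enc G \<in> ?U"
      using cls[OF G] by simp
  qed
  moreover have "finite ?U"
    using finite_graph_classes walks by (intro finite_SigmaI) auto
  ultimately have "card \<G> \<le> card ?U"
    by (rule card_inj_on_le)
  also have "\<dots> = (\<Sum>c\<in>graph_classes n. card (walks (R c) n))"
    using finite_graph_classes walks by (intro card_SigmaI) auto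
  also have "\<dots> \<le> card (graph_classes n) * (n * 4 ^ (n - 1))"
    using sum_bounded_above[of "graph_classes n" "\<lambda>c. card (walks (R c) n)"] walks by simp
  finally show ?thesis .
qed

section \<open>A large family of Hamiltonian 4-regular graphs\<close>

definition cycle_step :: "nat \<Rightarrow> nat \<Rightarrow> nat" where
  "cycle_step n u = (if Suc u < n then Suc u else if u < n then 0 else u)"

definition cycle_plus :: "nat \<Rightarrow> (nat \<Rightarrow> nat) \<Rightarrow> nat pair_pre_digraph" where
  "cycle_plus n \<phi> = \<lparr>pverts = {..<n}, parcs = {(u, v). u < n \<and> v < n \<and>
     (v = cycle_step n u \<or> u = cycle_step n v \<or> v = \<phi> u \<or> u = \<phi> v)}\<rparr>"

lemma cycle_step_permutes: "cycle_step n permutes {..<n}"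
proof (rule inj_imp_permutes)
  show "inj_on (cycle_step n) {..<n}"
    by (rule inj_onI) (auto simp: cycle_step_def split: if_splits)
qed (auto simp: cycle_step_def)

text \<open>The neighbours of \<open>u\<close> are its images under the cycle, under
  \<open>\<phi>\<close>, and under their inverses. The assumptions exclude loops and coincidences
  among these four, and the path along the cycle gives connectedness.\<close>

lemma cycle_plus_regular:
  assumes n: "n \<ge> 3" and \<phi>: "\<phi> permutes {..<n}"
    and ne: "\<And>u. u < n \<Longrightarrow> \<phi> u \<noteq> u \<and> \<phi> (\<phi> u) \<noteq> u \<and> \<phi> u \<noteq> cycle_step n u \<and> cycle_step n (\<phi> u) \<noteq> u"
  shows "connected_simple_4_regular (cycle_plus n \<phi>)"
proof -
  let ?G = "cycle_plus n \<phi>" and ?c = "cycle_step n"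
  let ?c' = "inv_into UNIV ?c" and ?\<phi>' = "inv_into UNIV \<phi>"
  have c: "?c u \<noteq> u" "?c (?c u) \<noteq> u" if "u < n" for u
    using n that by (auto simp: cycle_step_def)
  have less: "?c u < n" "\<phi> u < n" "?c' u < n" "?\<phi>' u < n" if "u < n" for u
    using that permutes_in_image[OF \<phi>] permutes_in_image[OF cycle_step_permutes[of n]]
      permutes_in_image[OF permutes_inv[OF \<phi>]]
      permutes_in_image[OF permutes_inv[OF cycle_step_permutes[of n]]] by auto
  note inv = permutes_inverses[OF \<phi>] permutes_inverses[OF cycle_step_permutes[of n]]
  have "pair_graph ?G"
  proof
    show "symmetric (with_proj ?G)"
      unfolding symmetric_def by (auto simp: cycle_plus_def intro: symI)
    show "finite (parcs ?G)"
      by (rule finite_subset[of _ "{..<n} \<times> {..<n}"]) (auto simp: cycle_plus_def)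
    show "fst e \<noteq> snd e" if "e \<in> parcs ?G" for e
      using that c(1) ne by (auto simp: cycle_plus_def) metis+
  qed (auto simp: cycle_plus_def)
  moreover have "Digraph_Component.connected (with_proj ?G)"
  proof -
    let ?R = "rtrancl_on {..<n} ((parcs ?G)\<^sup>s)"
    have step: "(u, Suc u) \<in> (parcs ?G)\<^sup>s" "(Suc u, u) \<in> (parcs ?G)\<^sup>s" if "Suc u < n" for u
      using that by (auto simp: symcl_def cycle_plus_def cycle_step_def)
    have "(0, u) \<in> ?R \<and> (u, 0) \<in> ?R" if "u < n" for u
      using that
    proof (induction u)
      case (Suc u)
      then have IH: "(0, u) \<in> ?R" "(u, 0) \<in> ?R"
        by auto
      show ?case
        using rtrancl_on_into_rtrancl_on[OF IH(1) step(1)]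
          converse_rtrancl_on_into_rtrancl_on[OF step(2) IH(2)] Suc.prems by auto
    qed (use n in auto)
    then have "(u, v) \<in> ?R" if "u < n" "v < n" for u v
      using that rtrancl_on_trans by metis
    moreover have "{..<n} \<noteq> {}"
      using n by (simp add: lessThan_empty_iff)
    ultimately show ?thesis
      by (simp add: connected_conv cycle_plus_def)
  qed
  moreover have "out_degree (with_proj ?G) u = 4" if u: "u \<in> pverts ?G" for u
  proof -
    have u: "u < n"
      using u by (simp add: cycle_plus_def)
    have "u = ?c v \<longleftrightarrow> v = ?c' u" "u = \<phi> v \<longleftrightarrow> v = ?\<phi>' u" for v
      using inv by metis+
    then have "(u, v) \<in> parcs ?G \<longleftrightarrow> v \<in> {?c u, ?c' u, \<phi> u, ?\<phi>' u}" for v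
      using u less[OF u] by (auto simp: cycle_plus_def)
    then have "out_arcs (with_proj ?G) u = Pair u ` {?c u, ?c' u, \<phi> u, ?\<phi>' u}"
      unfolding out_arcs_def by force
    then have "out_degree (with_proj ?G) u = card {?c u, ?c' u, \<phi> u, ?\<phi>' u}"
      unfolding out_degree_def by (metis Pair_inject card_image inj_onI)
    moreover have "?c u \<noteq> ?c' u" "\<phi> u \<noteq> ?\<phi>' u" "?c u \<noteq> \<phi> u"
      using u c(2) ne inv by metis+
    \<comment> \<open>The first and the third follow from \<open>ne\<close> at the vertex
      \<open>?\<phi>' u\<close>, the second from \<open>ne\<close> at \<open>u\<close>.\<close>
    moreover have "?c u \<noteq> ?\<phi>' u" "?c' u \<noteq> \<phi> u" "?c' u \<noteq> ?\<phi>' u"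
      using u less ne inv by metis+
    ultimately show ?thesis by simp
  qed
  ultimately show ?thesis
    unfolding connected_simple_4_regular_def by blast
qed

text \<open>The intervals \<open>[0, m)\<close>, \<open>[m, 2 m)\<close>, \<open>[2 m, 3 m)\<close> are permuted cyclically; the remaining
  vertices are moved two steps along a cycle of their own. The permutations \<open>\<sigma>\<^sub>1\<close> and \<open>\<sigma>\<^sub>2\<close> will
  fix \<open>m - 1\<close>, which keeps the new edges away from the edges \<open>{m - 1, m}\<close> and
  \<open>{2 m - 1, 2 m}\<close> of the Hamiltonian path.\<close>

definition block_map ::
    "nat \<Rightarrow> nat \<Rightarrow> (nat \<Rightarrow> nat) \<Rightarrow> (nat \<Rightarrow> nat) \<Rightarrow> (nat \<Rightarrow> nat) \<Rightarrow> nat \<Rightarrow> nat" where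
  "block_map m n \<sigma>\<^sub>1 \<sigma>\<^sub>2 \<sigma>\<^sub>3 u =
    (if u < m then m + \<sigma>\<^sub>1 u else if u < 2 * m then 2 * m + \<sigma>\<^sub>2 (u - m)
     else if u < 3 * m then \<sigma>\<^sub>3 (u - 2 * m) else if u + 2 < n then u + 2
     else if u < n then u + 2 + 3 * m - n else u)"

text \<open>At least five vertices remain beyond \<open>3 * m\<close>. On a cycle of that length a
  shift by two has no fixed point, is not an involution and never leads to a neighbour.\<close>

locale blocks =
  fixes m n :: nat and \<sigma>\<^sub>1 \<sigma>\<^sub>2 \<sigma>\<^sub>3 :: "nat \<Rightarrow> nat"
  assumes m: "m > 1" and n: "3 * m + 5 \<le> n"
    and \<sigma>: "\<sigma>\<^sub>1 permutes {..<m - 1}" "\<sigma>\<^sub>2 permutes {..<m - 1}" "\<sigma>\<^sub>3 permutes {..<m - 1}"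
begin

abbreviation "\<phi> \<equiv> block_map m n \<sigma>\<^sub>1 \<sigma>\<^sub>2 \<sigma>\<^sub>3"

lemma \<sigma>_less: "\<sigma>\<^sub>1 x < m" "\<sigma>\<^sub>2 x < m" "\<sigma>\<^sub>3 x < m" if "x < m"
proof -
  have "\<sigma>' x < m" if "\<sigma>' permutes {..<m - 1}" for \<sigma>'
    using permutes_in_image[OF that, of x] permutes_not_in[OF that, of x] \<open>x < m\<close>
    by (cases "x < m - 1") auto
  then show "\<sigma>\<^sub>1 x < m" "\<sigma>\<^sub>2 x < m" "\<sigma>\<^sub>3 x < m"
    using \<sigma> by auto
qed

lemma \<sigma>_last: "Suc x = m \<Longrightarrow> \<sigma>\<^sub>1 x = x" "Suc x = m \<Longrightarrow> \<sigma>\<^sub>2 x = x"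
  using permutes_not_in[OF \<sigma>(1)] permutes_not_in[OF \<sigma>(2)] by auto

text \<open>Offsets are written additively, so truncated subtraction disappears and linear
  arithmetic can finish.\<close>

lemma block_map_cases:
  assumes "u < n"
  obtains x where "x < m" "u = x" "\<phi> u = m + \<sigma>\<^sub>1 x" "\<sigma>\<^sub>1 x < m"
  | x where "x < m" "u = m + x" "\<phi> u = 2 * m + \<sigma>\<^sub>2 x" "\<sigma>\<^sub>2 x < m"
  | x where "x < m" "u = 2 * m + x" "\<phi> u = \<sigma>\<^sub>3 x" "\<sigma>\<^sub>3 x < m"
  | "3 * m \<le> u" "u + 2 < n" "\<phi> u = u + 2"
  | "3 * m \<le> u" "n \<le> u + 2" "\<phi> u + n = u + 2 + 3 * m"
proof -
  consider "u < m" | "m \<le> u" "u < 2 * m" | "2 * m \<le> u" "u < 3 * m" | "3 * m \<le> u" "u + 2 < n"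
    | "3 * m \<le> u" "n \<le> u + 2"
    by linarith
  then show thesis
  proof cases
    case 1 then show ?thesis using that(1)[of u] by (simp add: block_map_def \<sigma>_less)
  next
    case 2 then show ?thesis using that(2)[of "u - m"] \<sigma>_less[of "u - m"] by (simp add: block_map_def)
  next
    case 3 then show ?thesis using that(3)[of "u - 2 * m"] \<sigma>_less[of "u - 2 * m"] by (simp add: block_map_def)
  next
    case 4 then show ?thesis using that(4) by (simp add: block_map_def)
  next
    case 5 then show ?thesis using that(5) assms by (simp add: block_map_def)
  qed
qed

lemma block_map_less:
  assumes "u < n"
  shows "\<phi> u < n"
  by (rule block_map_cases[OF assms]) (use n assms in auto)

lemma block_map_permutes: "\<phi> permutes {..<n}"
proof (rule inj_imp_permutes)
  have inj: "\<sigma>\<^sub>1 x = \<sigma>\<^sub>1 y \<longleftrightarrow> x = y" "\<sigma>\<^sub>2 x = \<sigma>\<^sub>2 y \<longleftrightarrow> x = y" "\<sigma>\<^sub>3 x = \<sigma>\<^sub>3 y \<longleftrightarrow> x = y" for x y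
    using \<sigma>[THEN permutes_inj] by (auto dest: injD)
  show "inj_on \<phi> {..<n}"
  proof (rule inj_onI)
    fix u v assume "u \<in> {..<n}" "v \<in> {..<n}" and eq: "\<phi> u = \<phi> v"
    then have "u < n" "v < n" by auto
    show "u = v"
      \<comment> \<open>Different pieces have disjoint ranges; within one piece the claim is linear
        or the injectivity of a \<open>\<sigma>\<close>.\<close>
      by ((rule block_map_cases[OF \<open>u < n\<close>]; rule block_map_cases[OF \<open>v < n\<close>]);
        use eq n \<open>u < n\<close> \<open>v < n\<close> in \<open>linarith | simp add: inj\<close>)
  qed
  show "\<phi> u = u" if "u \<notin> {..<n}" for u
    using that n by (simp add: block_map_def)
qed (use block_map_less in auto)

text \<open>One or two steps always leave each of the first three blocks. The cycle joins two of
  them only by \<open>{m - 1, m}\<close> and \<open>{2 m - 1, 2 m}\<close>, and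
  \<open>\<phi>\<close> avoids these because \<open>m - 1\<close> is fixed and differs from
  \<open>0\<close> for \<open>m > 1\<close>.\<close>

lemma block_map_ne:
  assumes "u < n"
  shows "\<phi> u \<noteq> u \<and> \<phi> (\<phi> u) \<noteq> u \<and> \<phi> u \<noteq> cycle_step n u \<and> cycle_step n (\<phi> u) \<noteq> u"
  using assms
proof (cases u rule: block_map_cases)
  case (1 x)
  then show ?thesis
    using m n \<sigma>_less(1)[of x] \<sigma>_last(1)[of x] by (auto simp: cycle_step_def block_map_def)
next
  case (2 x)
  then show ?thesis
    using m n \<sigma>_less(2)[of x] \<sigma>_less(3)[of "\<sigma>\<^sub>2 x"] \<sigma>_last(2)[of x]
    by (auto simp: cycle_step_def block_map_def)
next
  case (3 x)
  then show ?thesis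
    using m n \<sigma>_less(3)[of x] \<sigma>_less(1)[of "\<sigma>\<^sub>3 x"]
    by (auto simp: cycle_step_def block_map_def)
next
  case 4
  then show ?thesis
    using n by (auto simp: cycle_step_def block_map_def)
next
  case 5
  then show ?thesis
    using n assms by (auto simp: cycle_step_def block_map_def)
qed

lemma connected_simple_4_regular_blocks: "connected_simple_4_regular (cycle_plus n \<phi>)"
  using n block_map_permutes block_map_ne by (intro cycle_plus_regular) auto

end

text \<open>An arc from \<open>u\<close> to its image is no cycle edge, so the other map produces it
  too, forwards or backwards. Backwards is impossible, as a second step reaches the third block
  instead of returning.\<close>

lemma block_map_determined:
  assumes "blocks m n \<sigma>\<^sub>1 \<sigma>\<^sub>2 \<sigma>\<^sub>3" "blocks m n \<tau>\<^sub>1 \<tau>\<^sub>2 \<tau>\<^sub>3"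
    and eq: "cycle_plus n (block_map m n \<sigma>\<^sub>1 \<sigma>\<^sub>2 \<sigma>\<^sub>3) = cycle_plus n (block_map m n \<tau>\<^sub>1 \<tau>\<^sub>2 \<tau>\<^sub>3)"
    and x: "x < m"
  shows "\<sigma>\<^sub>1 x = \<tau>\<^sub>1 x \<and> \<sigma>\<^sub>2 x = \<tau>\<^sub>2 x \<and> \<sigma>\<^sub>3 x = \<tau>\<^sub>3 x"
proof -
  interpret S: blocks m n \<sigma>\<^sub>1 \<sigma>\<^sub>2 \<sigma>\<^sub>3 by fact
  interpret T: blocks m n \<tau>\<^sub>1 \<tau>\<^sub>2 \<tau>\<^sub>3 by fact
  have arc: "S.\<phi> u = T.\<phi> u \<or> u = T.\<phi> (S.\<phi> u)" if u: "u < n" for u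
  proof -
    have "(u, S.\<phi> u) \<in> parcs (cycle_plus n S.\<phi>)"
      using u S.block_map_less by (simp add: cycle_plus_def)
    then have "(u, S.\<phi> u) \<in> parcs (cycle_plus n T.\<phi>)"
      using eq by simp
    then show ?thesis
      using S.block_map_ne[OF u] by (auto simp: cycle_plus_def)
  qed
  have "\<sigma>\<^sub>1 x = \<tau>\<^sub>1 x"
    using arc[of x] x S.n S.\<sigma>_less[OF x] by (auto simp: block_map_def)
  moreover have "\<sigma>\<^sub>2 x = \<tau>\<^sub>2 x"
    using arc[of "m + x"] x S.n S.\<sigma>_less[OF x] T.\<sigma>_less[OF S.\<sigma>_less(2)[OF x]]
    by (auto simp: block_map_def)
  moreover have "\<sigma>\<^sub>3 x = \<tau>\<^sub>3 x"
    using arc[of "2 * m + x"] x S.n S.\<sigma>_less[OF x] T.\<sigma>_less[OF S.\<sigma>_less(3)[OF x]]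
    by (auto simp: block_map_def)
  ultimately show ?thesis by blast
qed

lemma card_graph_classes_ge:
  assumes m: "m > 1" and n: "3 * m + 5 \<le> n"
  shows "fact (m - 1) ^ 3 \<le> card (graph_classes n) * (n * 4 ^ (n - 1))"
proof -
  let ?P = "{\<sigma>. \<sigma> permutes {..<m - 1}}"
  define G where "G = (\<lambda>(\<sigma>\<^sub>1, \<sigma>\<^sub>2, \<sigma>\<^sub>3). cycle_plus n (block_map m n \<sigma>\<^sub>1 \<sigma>\<^sub>2 \<sigma>\<^sub>3))"
  have blocks: "blocks m n \<sigma>\<^sub>1 \<sigma>\<^sub>2 \<sigma>\<^sub>3" if "(\<sigma>\<^sub>1, \<sigma>\<^sub>2, \<sigma>\<^sub>3) \<in> ?P \<times> ?P \<times> ?P" for \<sigma>\<^sub>1 \<sigma>\<^sub>2 \<sigma>\<^sub>3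
    using that m n by (simp add: blocks_def)
  have "inj_on G (?P \<times> ?P \<times> ?P)"
  proof (rule inj_onI, clarify)
    fix \<sigma>\<^sub>1 \<sigma>\<^sub>2 \<sigma>\<^sub>3 \<tau>\<^sub>1 \<tau>\<^sub>2 \<tau>\<^sub>3
    assume P: "\<sigma>\<^sub>1 permutes {..<m - 1}" "\<sigma>\<^sub>2 permutes {..<m - 1}" "\<sigma>\<^sub>3 permutes {..<m - 1}"
        "\<tau>\<^sub>1 permutes {..<m - 1}" "\<tau>\<^sub>2 permutes {..<m - 1}" "\<tau>\<^sub>3 permutes {..<m - 1}"
      and eq: "G (\<sigma>\<^sub>1, \<sigma>\<^sub>2, \<sigma>\<^sub>3) = G (\<tau>\<^sub>1, \<tau>\<^sub>2, \<tau>\<^sub>3)"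
    have "\<sigma>\<^sub>1 x = \<tau>\<^sub>1 x \<and> \<sigma>\<^sub>2 x = \<tau>\<^sub>2 x \<and> \<sigma>\<^sub>3 x = \<tau>\<^sub>3 x" if "x < m" for x
      using eq P by (intro block_map_determined[OF blocks blocks _ that]) (auto simp: G_def)
    moreover have "\<sigma>\<^sub>1 x = \<tau>\<^sub>1 x \<and> \<sigma>\<^sub>2 x = \<tau>\<^sub>2 x \<and> \<sigma>\<^sub>3 x = \<tau>\<^sub>3 x" if "\<not> x < m" for x
      using P[THEN permutes_not_in, of x] that by simp
    ultimately show "\<sigma>\<^sub>1 = \<tau>\<^sub>1 \<and> (\<sigma>\<^sub>2, \<sigma>\<^sub>3) = (\<tau>\<^sub>2, \<tau>\<^sub>3)"
      by (auto simp: fun_eq_iff)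
  qed
  then have "card (G ` (?P \<times> ?P \<times> ?P)) = fact (m - 1) ^ 3"
    by (simp add: card_image card_cartesian_product card_permutations power3_eq_cube)
  moreover have "card (G ` (?P \<times> ?P \<times> ?P)) \<le> card (graph_classes n) * (n * 4 ^ (n - 1))"
  proof (rule card_path_graphs_le)
    fix H assume "H \<in> G ` (?P \<times> ?P \<times> ?P)"
    then obtain \<sigma>\<^sub>1 \<sigma>\<^sub>2 \<sigma>\<^sub>3 where H: "H = cycle_plus n (block_map m n \<sigma>\<^sub>1 \<sigma>\<^sub>2 \<sigma>\<^sub>3)"
      "(\<sigma>\<^sub>1, \<sigma>\<^sub>2, \<sigma>\<^sub>3) \<in> ?P \<times> ?P \<times> ?P"
      unfolding G_def by force
    then show "connected_simple_4_regular H \<and> pverts H = {..<n} \<and>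
        (\<forall>u. Suc u < n \<longrightarrow> (u, Suc u) \<in> parcs H)"
      using blocks.connected_simple_4_regular_blocks[OF blocks[OF H(2)]]
      by (auto simp: cycle_plus_def cycle_step_def)
  qed (use n in simp)
  ultimately show ?thesis by simp
qed

section \<open>Comparison of the two bounds\<close>

text \<open>The quotient of the two sides decreases up to \<open>n = 29\<close> and increases afterwards, so it suffices
  to look at the ends of the range.\<close>

lemma fact_bound_upto_60:
  fixes n :: nat
  assumes "n \<ge> 1" "n \<le> 60"
  shows "24 * n * 24 ^ n * fact n \<le> 729 ^ n"
proof -
  \<comment> \<open>The left side grows by the factor \<open>24 (n + 1)^2 / n\<close>, to be
    compared with \<open>729\<close>; the equation is multiplied by \<open>n\<close> to stay in the
    naturals.\<close>
  have ratio: "24 * Suc n * 24 ^ Suc n * fact (Suc n) * n = (24 * n * 24 ^ n * fact n) * (24 * (Suc n)\<^sup>2)"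
    for n :: nat
    by (simp add: power2_eq_square algebra_simps)
  show ?thesis
  proof (cases "n \<le> 29")
    case True
    with assms(1) show ?thesis
    proof (induction n rule: dec_induct)
      case (step n)
      \<comment> \<open>With \<open>n = d + 1\<close> and \<open>d \<le> 27\<close>, bounding
        \<open>d * d\<close> by \<open>27 * d\<close> leaves a linear inequality.\<close>
      then obtain d where d: "n = Suc d" "d \<le> 27"
        by (cases n) auto
      then have "d * d \<le> 27 * d"
        by simp
      moreover have "24 * (Suc n)\<^sup>2 = 24 * (d * d) + 96 * d + 96"
        using d(1) by (simp add: power2_eq_square)
      ultimately have "24 * (Suc n)\<^sup>2 \<le> 729 * n"
        using d by linarith
      moreover have "24 * n * 24 ^ n * fact n \<le> 729 ^ n"
        using step by simp
      ultimately have "(24 * n * 24 ^ n * fact n) * (24 * (Suc n)\<^sup>2) \<le> 729 ^ n * (729 * n)"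
        using mult_le_mono by blast
      then have "(24 * Suc n * 24 ^ Suc n * fact (Suc n)) * n \<le> 729 ^ Suc n * n"
        unfolding ratio by (simp add: algebra_simps)
      then show ?case
        using step.hyps(1) by (simp only: mult_le_cancel2)
    qed simp
  next
    case False
    from assms(2) False show ?thesis
    \<comment> \<open>The growth factor is now at least \<open>729\<close>, so the inequality
      descends from \<open>n = 60\<close>.\<close>
    proof (induction n rule: inc_induct)
      case base
      show ?case by (simp add: fact_numeral)
    next
      case (step n)
      then have "29 * n \<le> n * n"
        by simp
      moreover have "24 * (Suc n)\<^sup>2 = 24 * (n * n) + 48 * n + 24"
        by (simp add: power2_eq_square)
      ultimately have "729 * n \<le> 24 * (Suc n)\<^sup>2"
        by linarith
      then have "(24 * n * 24 ^ n * fact n) * (729 * n) \<le> (24 * n * 24 ^ n * fact n) * (24 * (Suc n)\<^sup>2)"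
        by (rule mult_le_mono2)
      also have "\<dots> \<le> 729 ^ Suc n * n"
        unfolding ratio[symmetric] using step by (intro mult_le_mono1) auto
      finally have "(24 * n * 24 ^ n * fact n) * (729 * n) \<le> 729 ^ n * (729 * n)"
        by (simp add: algebra_simps)
      then show ?case
        using step.prems by (simp only: mult_le_cancel2)
    qed
  qed
qed

text \<open>The three new factors are each at most \<open>3 (m + 1)\<close>. Equivalently, the
  trinomial coefficient \<open>(3 m)! / (m!)^3\<close> is at most
  \<open>3 ^ (3 * m)\<close>.\<close>

lemma fact_triple_le: "fact (3 * m) \<le> (27 ^ m * fact m ^ 3 :: nat)"
proof (induction m)
  case (Suc m)
  have "3 * Suc m = Suc (Suc (Suc (3 * m)))"
    by simp
  then have "fact (3 * Suc m) = fact (3 * m) * ((3 * m + 1) * (3 * m + 2) * (3 * m + 3) :: nat)"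
    by (simp only: fact_Suc of_nat_id) (simp add: algebra_simps)
  also have "\<dots> \<le> (27 ^ m * fact m ^ 3) * (3 * Suc m * (3 * Suc m) * (3 * Suc m))"
    by (intro mult_le_mono Suc.IH) auto
  also have "\<dots> = 27 ^ Suc m * fact (Suc m) ^ 3"
    by (simp only: fact_Suc of_nat_id power_mult_distrib) (simp add: power3_eq_cube algebra_simps)
  finally show ?case .
qed simp

lemma fact_add_le: "fact (a + r) \<le> ((a + r) ^ r * fact a :: nat)"
proof (induction r)
  case (Suc r)
  have "fact (a + Suc r) = Suc (a + r) * fact (a + r)"
    by simp
  also have "\<dots> \<le> Suc (a + r) * (Suc (a + r) ^ r * fact a)"
    using Suc.IH by (intro mult_le_mono le_refl) (meson le_SucI le_refl le_trans mult_le_mono1 power_mono zero_le)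
  finally show ?case
    by (simp only: add_Suc_right power_Suc mult.assoc)
qed simp

lemma power_12_bound:
  fixes n :: nat
  assumes "n \<ge> 60"
  shows "6 * n ^ 12 * 288 ^ n \<le> 729 ^ n"
  using assms
proof (induction n rule: dec_induct)
  case base
  show ?case by simp
next
  case (step n)
  \<comment> \<open>For \<open>n \<ge> 60\<close> the successor is at most \<open>61 n / 60\<close>,
    and \<open>(61 / 60)^12 * 288 < 729\<close>.\<close>
  have "(60 * Suc n) ^ 12 \<le> (61 * n) ^ 12"
    using step.hyps by (intro power_mono) auto
  then have "60 ^ 12 * (Suc n ^ 12 * 288) \<le> n ^ 12 * (61 ^ 12 * 288)"
    unfolding power_mult_distrib by simp
  also have "\<dots> \<le> n ^ 12 * (60 ^ 12 * 729)"
    by (intro mult_le_mono2) simp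
  finally have "Suc n ^ 12 * 288 \<le> n ^ 12 * 729"
    by simp
  then have "6 * Suc n ^ 12 * 288 ^ Suc n \<le> 6 * 288 ^ n * (n ^ 12 * 729)"
    by simp
  also have "\<dots> \<le> 729 ^ n * 729"
    using step.IH by simp
  finally show ?case
    by simp
qed

text \<open>\<open>m\<close> is the largest block size with \<open>3 * m + 5 \<le> n\<close>. The
  exponent \<open>12\<close> collects \<open>7\<close> from the at most seven leftover factors,
  \<open>3\<close> from passing from \<open>m\<close> to \<open>m - 1\<close> in three factorials,
  and \<open>2\<close> from the linear factors; the base is \<open>288 = 24 * 4 * 3\<close>.\<close>

lemma fact_bound_from_60:
  fixes n :: nat
  assumes n: "n \<ge> 60" and m: "m = (n - 5) div 3"
  shows "(24 * n * 24 ^ n * fact n) * (n * 4 ^ (n - 1)) \<le> 729 ^ n * fact (m - 1) ^ 3"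
proof -
  define r where "r = n - 3 * m"
  have nr: "n = 3 * m + r" and r: "r \<le> 7" and m0: "m > 0"
    using n unfolding m r_def by auto
  obtain l where l: "m = Suc l"
    using m0 gr0_implies_Suc by blast
  have "fact n \<le> n ^ r * fact (3 * m)"
    using fact_add_le[of "3 * m" r] nr by simp
  also have "\<dots> \<le> n ^ 7 * (27 ^ m * fact m ^ 3)"
    using n r by (intro mult_le_mono fact_triple_le power_increasing) auto
  also have "\<dots> = n ^ 7 * m ^ 3 * 27 ^ m * fact (m - 1) ^ 3"
    by (simp only: l fact_Suc of_nat_id power_mult_distrib) simp
  also have "\<dots> \<le> n ^ 7 * n ^ 3 * 3 ^ n * fact (m - 1) ^ 3"
  proof -
    have "27 ^ m = (3 ^ (3 * m) :: nat)"
      by (simp add: power_mult)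
    also have "\<dots> \<le> 3 ^ n"
      using nr by (intro power_increasing) auto
    finally show ?thesis
      using nr by (intro mult_le_mono power_mono) auto
  qed
  finally have fact: "fact n \<le> n ^ 10 * 3 ^ n * fact (m - 1) ^ 3"
    by (simp flip: power_add)
  have four: "4 * 4 ^ (n - 1) = (4 ^ n :: nat)"
    using n by (cases n) auto
  have "(24 * n * 24 ^ n * fact n) * (n * 4 ^ (n - 1)) = 6 * n ^ 2 * (24 ^ n * (4 * 4 ^ (n - 1))) * fact n"
    by (simp add: power2_eq_square)
  also have "\<dots> = 6 * n ^ 2 * 96 ^ n * fact n"
    unfolding four by (simp flip: power_mult_distrib)
  also have "\<dots> \<le> 6 * n ^ 2 * 96 ^ n * (n ^ 10 * 3 ^ n * fact (m - 1) ^ 3)"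
    using fact by (rule mult_le_mono2)
  also have "\<dots> = 6 * (n ^ 2 * n ^ 10) * (96 ^ n * 3 ^ n) * fact (m - 1) ^ 3"
    by simp
  also have "\<dots> = 6 * n ^ 12 * 288 ^ n * fact (m - 1) ^ 3"
    by (simp flip: power_mult_distrib power_add)
  also have "\<dots> \<le> 729 ^ n * fact (m - 1) ^ 3"
    using power_12_bound[OF n] by (rule mult_le_mono1)
  finally show ?thesis .
qed

section \<open>Logarithms and the final comparison\<close>

lemma manifold_classes_0: "manifold_classes 0 = {}"
  by (simp add: manifold_classes_def one_edge_manifold_def triangulation_edges_def tetrahedra_edges_def)

text \<open>\<open>729 = 2.7 * 270\<close> and \<open>2.7 \<le> e\<close>.\<close>

lemma ln_729_le: "ln 729 \<le> 1 + ln (270 :: real)"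
proof -
  have "exp 1 \<ge> (27 / 10 :: real)"
    using e_approx_32 by (simp add: abs_if split: if_splits)
  then have "(729 :: real) \<le> exp 1 * 270"
    by simp
  then have "ln 729 \<le> ln (exp 1 * 270 :: real)"
    by (subst ln_le_cancel_iff) auto
  then show ?thesis
    by (simp add: ln_mult)
qed

lemma ln_of_nat_nonneg: "0 \<le> ln (real k)"
  by (cases "k = 0") auto

text \<open>Finiteness is claimed as well, since \<open>card\<close> of an infinite set is
  \<open>0\<close> and would make the inequality say nothing about it.\<close>

theorem theorem2:
  fixes n :: nat
  shows "finite (manifold_classes n :: 'a topology set set) \<and>
    ln (real (card (manifold_classes n :: 'a topology set set)))
      \<le> ln (real (card (graph_classes n))) + real n * (1 + ln 270)"
proof (cases "n = 0")
  case True
  then show ?thesis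
    by (simp add: manifold_classes_0 ln_of_nat_nonneg)
next
  case False
  let ?M = "card (manifold_classes n :: 'a topology set set)" and ?A = "card (graph_classes n)"
  have M: "finite (manifold_classes n :: 'a topology set set)" "?M \<le> 24 * n * 24 ^ n * fact n"
    using card_manifold_classes[of n, where 'a = 'a] False by auto
  have ln729: "real n * ln 729 \<le> real n * (1 + ln 270)"
    using ln_729_le by (intro mult_left_mono) auto
  have "ln (real ?M) \<le> ln (real ?A) + real n * ln 729"
  proof (cases "?M = 0")
    case True
    then show ?thesis using ln_of_nat_nonneg[of ?A] by simp
  next
    case M0: False
    show ?thesis
    proof (cases "n \<le> 60")
      case True
      \<comment> \<open>There may be no graph at all here, for instance when \<open>n < 5\<close>;
        \<open>ln 0\<close> is \<open>0\<close>, so the bound on manifolds decides.\<close>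
      then have "?M \<le> 729 ^ n"
        using M(2) fact_bound_upto_60[of n] False by linarith
      then have "real ?M \<le> 729 ^ n"
        using of_nat_mono[of ?M "729 ^ n", where 'a = real] by simp
      then have "ln (real ?M) \<le> ln (729 ^ n)"
        using M0 by (subst ln_le_cancel_iff) auto
      then show ?thesis
        using ln_of_nat_nonneg[of ?A] by (simp add: ln_realpow)
    next
      case n: False
      let ?m = "(n - 5) div 3" and ?w = "n * 4 ^ (n - 1)"
      have "?M * ?w \<le> (24 * n * 24 ^ n * fact n) * ?w"
        using M(2) by (rule mult_le_mono1)
      also have "\<dots> \<le> 729 ^ n * fact (?m - 1) ^ 3"
        using n by (intro fact_bound_from_60) auto
      also have "\<dots> \<le> 729 ^ n * (?A * ?w)"
        using n by (intro mult_le_mono2 card_graph_classes_ge) auto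
      finally have "?M * ?w \<le> (729 ^ n * ?A) * ?w"
        by (simp only: mult.assoc)
      then have MA: "?M \<le> 729 ^ n * ?A"
        using False by (simp only: mult_le_cancel2) simp
      then have "real ?M \<le> 729 ^ n * real ?A"
        using of_nat_mono[OF MA, where 'a = real] by simp
      \<comment> \<open>At least one manifold exists in this case, so the product bound forces a
        graph to exist.\<close>
      moreover have "?A > 0"
        using MA M0 by (metis gr0I mult_0_right le_zero_eq)
      ultimately have "ln (real ?M) \<le> ln (729 ^ n * real ?A)"
        using M0 by (subst ln_le_cancel_iff) auto
      then show ?thesis
        using \<open>?A > 0\<close> by (simp add: ln_mult ln_realpow)
    qed
  qed
  then show ?thesis
    using M(1) ln729 by linarith
qed

end
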